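(* Let $1<p,q<\infty$ and let $t_0>0$ be fixed. Consider the nonlinear eigenvalue problem $$\big(\operatorname{sgn}(u'')|u''|^{p-1}\big)''=\lambda\, \operatorname{sgn}(u)|u|^{q-1}\quad (0\le t\le t_0),\qquad u(0)=u(t_0)=u''(0)=u''(t_0)=0. \qquad (\mathrm{E})$$ (i) If $p\neq q$, then for every $\lambda>0$ there exists a unique eigenfunction of (E) with eigenvalue $\lambda$ that is positive on $(0,t_0)$. (ii) If $p=q$, then there exists a unique $\lambda>0$ (depending on $t_0$) such that an eigenfunction of (E) positive on $(0,t_0)$ exists, and this eigenfunction is unique up to multiplication by a scalar.
   Context: An eigenpair of (E) is a pair $(u,\lambda)$ with $\lambda>0$ and a real function $u\not\equiv 0$ on $[0,t_0]$ satisfying (E); $u$ is then called an eigenfunction with eigenvalue $\lambda$. Solutions are understood in the sense that the vector $(u_1,u_2,w_1,w_2)=(u,\,u',\,-\operatorname{sgn}(u'')|u''|^{p-1},\,-(\operatorname{sgn}(u'')|u''|^{p-1})')$ is of class $C^1$ on $[0,t_0]$ and satisfies the first order system $u_1'=u_2$, $u_2'=-\operatorname{sgn}(w_1)|w_1|^{p'-1}$, $w_1'=w_2$, $w_2'=-\lambda \operatorname{sgn}(u_1)|u_1|^{q-1}$, where $p'=p/(p-1)$. *)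

theory Defs
  imports "HOL-Analysis.Analysis"
begin

definition signed_pow :: "real \<Rightarrow> real \<Rightarrow> real" where
  "signed_pow r x = sgn x * \<bar>x\<bar> powr (r - 1)"

definition conj_exponent :: "real \<Rightarrow> real" where
  "conj_exponent p = p / (p - 1)"

(* f is of class C^1 on [0,t0] with derivative f', one-sided at the end points. *)
definition has_C1_deriv_on :: "real \<Rightarrow> (real \<Rightarrow> real) \<Rightarrow> (real \<Rightarrow> real) \<Rightarrow> bool" where
  "has_C1_deriv_on t0 f f' \<longleftrightarrow>
     (\<forall>t\<in>{0..t0}. (f has_real_derivative f' t) (at t within {0..t0})) \<and>
     continuous_on {0..t0} f'"

(* The witnesses du, ddu stand for u', u'', and w1 = - sgn(u'')|u''|^(p-1), w2 = w1'.
   For t0 > 0 they are determined by u on [0,t0].  The vector (u, du, w1, w2) is C^1 and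
   satisfies the first order system; the last line is the boundary condition. *)
definition solves_E :: "real \<Rightarrow> real \<Rightarrow> real \<Rightarrow> real \<Rightarrow> (real \<Rightarrow> real) \<Rightarrow> bool" where
  "solves_E p q t0 lam u \<longleftrightarrow>
     (\<exists>du ddu w1 w2.
        has_C1_deriv_on t0 u du \<and>
        has_C1_deriv_on t0 du ddu \<and>
        (\<forall>t\<in>{0..t0}. w1 t = - signed_pow p (ddu t)) \<and>
        (\<forall>t\<in>{0..t0}. ddu t = - signed_pow (conj_exponent p) (w1 t)) \<and>
        has_C1_deriv_on t0 w1 w2 \<and>
        has_C1_deriv_on t0 w2 (\<lambda>t. - lam * signed_pow q (u t)) \<and>
        u 0 = 0 \<and> u t0 = 0 \<and> ddu 0 = 0 \<and> ddu t0 = 0)"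

(* Functions on [0,t0] are represented by total functions whose values outside [0,t0]
   are irrelevant. *)
definition eigenpair :: "real \<Rightarrow> real \<Rightarrow> real \<Rightarrow> (real \<Rightarrow> real) \<Rightarrow> real \<Rightarrow> bool" where
  "eigenpair p q t0 u lam \<longleftrightarrow>
     lam > 0 \<and> (\<exists>t\<in>{0..t0}. u t \<noteq> 0) \<and> solves_E p q t0 lam u"

definition positive_eigenpair :: "real \<Rightarrow> real \<Rightarrow> real \<Rightarrow> (real \<Rightarrow> real) \<Rightarrow> real \<Rightarrow> bool" where
  "positive_eigenpair p q t0 u lam \<longleftrightarrow>
     eigenpair p q t0 u lam \<and> (\<forall>t\<in>{0<..<t0}. u t > 0)"

end

theory Submission
  imports Defs
begin

text \<open>With \<open>a = 1 / (p - 1)\<close>, \<open>b = q - 1\<close> and \<open>w = - sgn (u'') |u''| ^ (p - 1)\<close>, the positive eigenfunctions are the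
  positive solutions of the Dirichlet problem \<open>u'' = - w ^ a\<close>, \<open>w'' = - lam * u ^ b\<close>.

  Uniqueness: rescaling time and both amplitudes brings any two solutions to the same \<open>lam\<close> and the same
  \<open>u' 0\<close>, at the price of different interval lengths. If the slopes \<open>w' 0\<close> differed, then by
  competitiveness the solution with the larger slope would have the larger \<open>w\<close> and the smaller \<open>u\<close>, so
  at the smaller of the two end points one component of the solution ending there would still be positive.
  Hence the initial data agree, the solutions agree, and so do the interval lengths.

  Existence: on the half interval, with both functions normalised to \<open>1\<close> at the centre, the normalised
  solution operator is monotone for the order given by \<open>g / f\<close> being nonincreasing, whatever the
  degree of homogeneity \<open>a * b\<close>. Iterating it from the constant \<open>1\<close> gives a decreasing sequence of
  concave profiles, whose limit solves the system up to two constant factors; rescaling the amplitudes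
  removes these, except that for \<open>a * b = 1\<close> it only determines \<open>lam\<close>.\<close>

section \<open>Functions with a one-sided derivative on an interval\<close>

lemma mvt_within:
  fixes g :: "real \<Rightarrow> real"
  assumes "\<And>x. x \<in> {0..T} \<Longrightarrow> (g has_real_derivative g' x) (at x within {0..T})"
    and "0 \<le> s" "s < t" "t \<le> T"
  obtains x where "s < x" "x < t" "g t - g s = (t - s) * g' x"
proof -
  have "\<exists>x\<in>{s<..<t}. g t - g s = (\<lambda>h. h * g' x) (t - s)"
  proof (rule mvt_simple)
    show "s < t" by fact
    fix x assume "s \<le> x" "x \<le> t"
    then have "(g has_real_derivative g' x) (at x within {s..t})"
      using assms by (intro has_field_derivative_subset[OF assms(1)]) auto
    then show "(g has_derivative (\<lambda>h. h * g' x)) (at x within {s..t})"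
      by (simp add: has_field_derivative_def mult.commute[of _ "g' x"])
  qed
  then show ?thesis using that by auto
qed

lemma mono_within:
  fixes g :: "real \<Rightarrow> real"
  assumes "\<And>x. x \<in> {0..T} \<Longrightarrow> (g has_real_derivative g' x) (at x within {0..T})"
    and "\<And>x. 0 < x \<Longrightarrow> x < T \<Longrightarrow> 0 \<le> g' x"
    and "0 \<le> s" "s \<le> t" "t \<le> T"
  shows "g s \<le> g t"
proof (cases "s = t")
  case False
  then obtain x where "s < x" "x < t" "g t - g s = (t - s) * g' x"
    using mvt_within[of T g g' s t] assms by auto
  moreover have "0 \<le> g' x" using assms(2)[of x] assms(3,5) calculation by auto
  ultimately have "0 \<le> g t - g s" by simp
  then show ?thesis by simp
qed simp

lemma antimono_within:
  fixes g :: "real \<Rightarrow> real"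
  assumes "\<And>x. x \<in> {0..T} \<Longrightarrow> (g has_real_derivative g' x) (at x within {0..T})"
    and "\<And>x. 0 < x \<Longrightarrow> x < T \<Longrightarrow> g' x \<le> 0"
    and "0 \<le> s" "s \<le> t" "t \<le> T"
  shows "g t \<le> g s"
  using mono_within[of T "\<lambda>x. - g x" "\<lambda>x. - g' x" s t] assms by (auto intro: DERIV_minus)

text \<open>Mean slopes to the left and to the right of \<open>t\<close> are ordered because
  \<open>g'\<close> is nonincreasing. So the graph lies above its chord from the origin, stated
  without division by \<open>T\<close>, and below its tangent at \<open>0\<close>.\<close>

lemma concave_chord:
  fixes g :: "real \<Rightarrow> real"
  assumes "\<And>x. x \<in> {0..T} \<Longrightarrow> (g has_real_derivative g' x) (at x within {0..T})"
    and anti: "\<And>s t. 0 \<le> s \<Longrightarrow> s \<le> t \<Longrightarrow> t \<le> T \<Longrightarrow> g' t \<le> g' s"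
    and "g 0 = 0" and "t \<in> {0..T}"
  shows "t * g T \<le> T * g t" and "g t \<le> t * g' 0"
proof -
  have "t * g T \<le> T * g t \<and> g t \<le> t * g' 0"
  proof (cases "t = 0")
    case True
    then show ?thesis using assms by auto
  next
    case False
    then have t: "0 < t" "t \<le> T" using assms by auto
    obtain x where x: "0 < x" "x < t" "g t - g 0 = (t - 0) * g' x"
      by (rule mvt_within[of T g g' 0 t]) (use assms t in auto)
    have "g' x \<le> g' 0" using anti x t by auto
    then have 1: "g t \<le> t * g' 0" using x t assms(3) by simp
    have "t * g T \<le> T * g t"
    proof (cases "t = T")
      case False
      obtain y where y: "t < y" "y < T" "g T - g t = (T - t) * g' y"
        by (rule mvt_within[of T g g' t T]) (use assms t False in auto)
      have "g' y \<le> g' x" using anti x y by auto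
      then have "t * ((T - t) * g' y) \<le> t * ((T - t) * g' x)"
        using t by (simp add: mult_left_mono)
      moreover have "t * ((T - t) * g' y) = t * (g T - g t)" "t * ((T - t) * g' x) = (T - t) * g t"
        using y(3) x(3) assms(3) by simp_all
      ultimately have "t * (g T - g t) \<le> (T - t) * g t" by simp
      then show ?thesis by (simp add: algebra_simps)
    qed simp
    then show ?thesis using 1 by simp
  qed
  then show "t * g T \<le> T * g t" and "g t \<le> t * g' 0" by auto
qed

text \<open>A nonpositive interior value would force a nonpositive slope somewhere before it and a
  nonnegative one after it, although \<open>g'\<close> is strictly decreasing.\<close>

lemma concave_pos:
  fixes g :: "real \<Rightarrow> real"
  assumes g: "\<And>x. x \<in> {0..T} \<Longrightarrow> (g has_real_derivative g' x) (at x within {0..T})"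
    and g': "\<And>x. x \<in> {0..T} \<Longrightarrow> (g' has_real_derivative g'' x) (at x within {0..T})"
    and neg: "\<And>x. 0 < x \<Longrightarrow> x < T \<Longrightarrow> g'' x < 0"
    and "g 0 = 0" "g T = 0" "0 < t" "t < T"
  shows "0 < g t"
proof (rule ccontr)
  assume n: "\<not> 0 < g t"
  obtain x where x: "0 < x" "x < t" "g t - g 0 = (t - 0) * g' x"
    by (rule mvt_within[of T g g' 0 t]) (use assms in auto)
  obtain y where y: "t < y" "y < T" "g T - g t = (T - t) * g' y"
    by (rule mvt_within[of T g g' t T]) (use assms in auto)
  obtain z where z: "x < z" "z < y" "g' y - g' x = (y - x) * g'' z"
    by (rule mvt_within[of T g' g'' x y]) (use assms x y in auto)
  have "g'' z < 0" using neg[of z] x y z by auto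
  then have "g' y < g' x" using z x y by (smt (verit) mult_pos_neg)
  moreover have "g' x \<le> 0" using x n \<open>0 < t\<close> assms(4) by (smt (verit) mult_pos_pos)
  moreover have "0 \<le> g' y" using y n \<open>t < T\<close> assms(5) by (smt (verit) mult_pos_neg)
  ultimately show False by simp
qed

text \<open>The derivative of the power is continuous, hence bounded, on a compact interval that
  stays away from \<open>0\<close>.\<close>

lemma powr_lipschitz_on_pos:
  fixes r k M :: real
  assumes "0 < k"
  obtains L where "0 < L" "\<And>x y. x \<in> {k..M} \<Longrightarrow> y \<in> {k..M} \<Longrightarrow> \<bar>x powr r - y powr r\<bar> \<le> L * \<bar>x - y\<bar>"
proof -
  have "continuous_on {k..M} (\<lambda>x. r * x powr (r - 1))"
    using assms by (intro continuous_intros) auto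
  then have "bounded ((\<lambda>x. r * x powr (r - 1)) ` {k..M})"
    by (intro compact_imp_bounded compact_continuous_image) auto
  then obtain L where L: "0 < L" "\<And>x. x \<in> {k..M} \<Longrightarrow> \<bar>r * x powr (r - 1)\<bar> \<le> L"
    unfolding bounded_pos by auto
  have "\<bar>x powr r - y powr r\<bar> \<le> L * \<bar>x - y\<bar>" if "x \<in> {k..M}" "y \<in> {k..M}" for x y
  proof -
    have "norm (x powr r - y powr r) \<le> L * norm (x - y)"
    proof (rule field_differentiable_bound[of "{k..M}"])
      fix z assume "z \<in> {k..M}"
      then show "((\<lambda>x. x powr r) has_real_derivative r * z powr (r - 1)) (at z within {k..M})"
        using assms by (intro has_field_derivative_at_within[OF has_real_derivative_powr]) auto
      show "norm (r * z powr (r - 1)) \<le> L" using L(2) \<open>z \<in> _\<close> by simp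
    qed (use that in auto)
    then show ?thesis by simp
  qed
  with L(1) show ?thesis by (rule that)
qed

section \<open>The Lane--Emden system from an end point\<close>

text \<open>Nonnegativity is built in because \<open>powr\<close> replaces the signed power. Values
  are prescribed at \<open>0\<close> only, so that solutions can be restricted to shorter intervals
  and compared through their initial slopes.\<close>

definition emden_ivp ::
  "real \<Rightarrow> real \<Rightarrow> real \<Rightarrow> real \<Rightarrow> (real \<Rightarrow> real) \<Rightarrow> (real \<Rightarrow> real) \<Rightarrow> (real \<Rightarrow> real) \<Rightarrow> (real \<Rightarrow> real) \<Rightarrow> bool"
where
  "emden_ivp a b lam T u du w dw \<longleftrightarrow>
     (\<forall>t\<in>{0..T}.
        (u has_real_derivative du t) (at t within {0..T}) \<and>
        (du has_real_derivative - (w t powr a)) (at t within {0..T}) \<and>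
        (w has_real_derivative dw t) (at t within {0..T}) \<and>
        (dw has_real_derivative - lam * u t powr b) (at t within {0..T}) \<and>
        0 \<le> u t \<and> 0 \<le> w t) \<and>
     u 0 = 0 \<and> w 0 = 0"

definition emden_bvp ::
  "real \<Rightarrow> real \<Rightarrow> real \<Rightarrow> real \<Rightarrow> (real \<Rightarrow> real) \<Rightarrow> (real \<Rightarrow> real) \<Rightarrow> (real \<Rightarrow> real) \<Rightarrow> (real \<Rightarrow> real) \<Rightarrow> bool"
where
  "emden_bvp a b lam T u du w dw \<longleftrightarrow>
     emden_ivp a b lam T u du w dw \<and> u T = 0 \<and> w T = 0 \<and> (\<forall>t\<in>{0<..<T}. 0 < u t \<and> 0 < w t)"

lemma emden_ivpD:
  assumes "emden_ivp a b lam T u du w dw"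
  shows "\<And>t. t \<in> {0..T} \<Longrightarrow> (u has_real_derivative du t) (at t within {0..T})"
    and "\<And>t. t \<in> {0..T} \<Longrightarrow> (du has_real_derivative - (w t powr a)) (at t within {0..T})"
    and "\<And>t. t \<in> {0..T} \<Longrightarrow> (w has_real_derivative dw t) (at t within {0..T})"
    and "\<And>t. t \<in> {0..T} \<Longrightarrow> (dw has_real_derivative - lam * u t powr b) (at t within {0..T})"
    and "\<And>t. t \<in> {0..T} \<Longrightarrow> 0 \<le> u t" and "\<And>t. t \<in> {0..T} \<Longrightarrow> 0 \<le> w t"
    and "u 0 = 0" and "w 0 = 0"
  using assms unfolding emden_ivp_def by auto

lemma emden_bvpD:
  assumes "emden_bvp a b lam T u du w dw"
  shows "emden_ivp a b lam T u du w dw" and "u T = 0" and "w T = 0"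
    and "\<And>t. 0 < t \<Longrightarrow> t < T \<Longrightarrow> 0 < u t" and "\<And>t. 0 < t \<Longrightarrow> t < T \<Longrightarrow> 0 < w t"
  using assms unfolding emden_bvp_def by auto

lemma emden_ivp_continuous:
  assumes "emden_ivp a b lam T u du w dw"
  shows "continuous_on {0..T} u" "continuous_on {0..T} du" "continuous_on {0..T} w" "continuous_on {0..T} dw"
  by (rule DERIV_continuous_on, erule emden_ivpD(1)[OF assms], rule DERIV_continuous_on, erule emden_ivpD(2)[OF assms],
      rule DERIV_continuous_on, erule emden_ivpD(3)[OF assms], rule DERIV_continuous_on, erule emden_ivpD(4)[OF assms])

lemma emden_ivp_subinterval:
  assumes "emden_ivp a b lam T u du w dw" "S \<le> T"
  shows "emden_ivp a b lam S u du w dw"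
proof -
  note D = emden_ivpD[OF assms(1)]
  have sub: "(g has_real_derivative g') (at t within {0..S})"
    if "(g has_real_derivative g') (at t within {0..T})" for g g' t
    by (rule has_field_derivative_subset[OF that]) (use assms(2) in auto)
  have "t \<in> {0..T}" if "t \<in> {0..S}" for t using that assms(2) by auto
  then show ?thesis
    unfolding emden_ivp_def using D(7,8) by (blast intro: sub D(1-6))
qed

lemma emden_ivp_antimono:
  assumes "emden_ivp a b lam T u du w dw" "0 \<le> lam" "0 \<le> s" "s \<le> t" "t \<le> T"
  shows "du t \<le> du s" and "dw t \<le> dw s"
proof -
  show "du t \<le> du s"
    by (rule antimono_within[of T du "\<lambda>t. - (w t powr a)"])
       (use assms emden_ivpD(2)[OF assms(1)] in auto)
  show "dw t \<le> dw s"
    by (rule antimono_within[of T dw "\<lambda>t. - lam * u t powr b"])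
       (use assms emden_ivpD(4)[OF assms(1)] in auto)
qed

text \<open>The system is competitive: a larger \<open>w\<close> pushes \<open>u\<close> down, and a smaller \<open>u\<close> pushes \<open>w\<close> up.\<close>

lemma emden_ivp_skew_comparison:
  assumes E1: "emden_ivp a b lam T u1 du1 w1 dw1" and E2: "emden_ivp a b lam T u2 du2 w2 dw2"
    and ab: "0 \<le> a" "0 \<le> b" "0 \<le> lam"
    and du0: "du1 0 = du2 0" and dw0: "dw1 0 < dw2 0"
    and t: "0 < t" "t \<le> T"
  shows "w1 t < w2 t" and "u2 t \<le> u1 t"
proof -
  note D1 = emden_ivpD[OF E1] and D2 = emden_ivpD[OF E2]
  \<comment> \<open>Bootstrap: while the gap between the slopes of \<open>w\<close> is positive, the
    orderings of \<open>w\<close>, then \<open>du\<close>, then \<open>u\<close> follow, and these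
    make the gap nondecreasing up to \<open>r\<close>.\<close>
  have step: "(\<forall>s\<in>{0..r}. u2 s \<le> u1 s) \<and> dw2 0 - dw1 0 \<le> dw2 r - dw1 r"
    if r: "0 \<le> r" "r \<le> T" and pos: "\<And>s. 0 \<le> s \<Longrightarrow> s < r \<Longrightarrow> 0 < dw2 s - dw1 s" for r
  proof -
    note R1 = emden_ivpD[OF emden_ivp_subinterval[OF E1 r(2)]]
    note R2 = emden_ivpD[OF emden_ivp_subinterval[OF E2 r(2)]]
    have w: "w1 s \<le> w2 s" if "s \<in> {0..r}" for s
    proof -
      have "w2 0 - w1 0 \<le> w2 s - w1 s"
        by (rule mono_within[OF DERIV_diff[OF R2(3) R1(3)]]) (use that pos in \<open>auto simp: less_imp_le\<close>)
      then show ?thesis using D1 D2 by simp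
    qed
    have du: "du2 s \<le> du1 s" if "s \<in> {0..r}" for s
    proof -
      have d: "((\<lambda>s. du1 s - du2 s) has_real_derivative w2 x powr a - w1 x powr a) (at x within {0..r})"
        if "x \<in> {0..r}" for x
        using DERIV_diff[OF R1(2)[OF that] R2(2)[OF that]] by simp
      have "w1 x powr a \<le> w2 x powr a" if "x \<in> {0..r}" for x
        using that w R1(6) ab by (intro powr_mono2) auto
      then have "du1 0 - du2 0 \<le> du1 s - du2 s"
        using that by (intro mono_within[OF d]) auto
      then show ?thesis using du0 by simp
    qed
    have u: "u2 s \<le> u1 s" if "s \<in> {0..r}" for s
    proof -
      have "u1 0 - u2 0 \<le> u1 s - u2 s"
        by (rule mono_within[OF DERIV_diff[OF R1(1) R2(1)]]) (use that du in auto)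
      then show ?thesis using D1 D2 by simp
    qed
    have d: "((\<lambda>s. dw2 s - dw1 s) has_real_derivative lam * (u1 x powr b - u2 x powr b)) (at x within {0..r})"
      if "x \<in> {0..r}" for x
      using DERIV_diff[OF R2(4)[OF that] R1(4)[OF that]] by (simp add: right_diff_distrib)
    have "u2 x powr b \<le> u1 x powr b" if "x \<in> {0..r}" for x
      using that u R2(5) ab by (intro powr_mono2) auto
    then have "dw2 0 - dw1 0 \<le> dw2 r - dw1 r"
      using r ab by (intro mono_within[OF d]) auto
    with u show ?thesis by simp
  qed
  have pos: "0 < dw2 s - dw1 s" if s: "0 \<le> s" "s \<le> T" for s
  proof (rule ccontr)
    assume "\<not> 0 < dw2 s - dw1 s"
    \<comment> \<open>The gap is positive before the first point of \<open>Z\<close>, so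
      \<open>step\<close> applies there and bounds the gap below by its positive initial
      value.\<close>
    define Z where "Z = {x \<in> {0..T}. dw2 x - dw1 x \<le> 0}"
    have "closed Z" unfolding Z_def
      by (intro continuous_on_closed_Collect_le continuous_on_diff continuous_on_const closed_atLeastAtMost
          emden_ivp_continuous[OF E1] emden_ivp_continuous[OF E2])
    moreover have "s \<in> Z" using s \<open>\<not> 0 < _\<close> unfolding Z_def by auto
    moreover have "bdd_below Z" unfolding Z_def by (auto intro: bdd_belowI[of _ 0])
    ultimately have Inf: "Inf Z \<in> Z" by (intro closed_contains_Inf) auto
    have "0 < dw2 x - dw1 x" if "0 \<le> x" "x < Inf Z" for x
      using that cInf_lower[of x Z] \<open>bdd_below Z\<close> Inf unfolding Z_def by force
    then have "dw2 0 - dw1 0 \<le> dw2 (Inf Z) - dw1 (Inf Z)"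
      using step[of "Inf Z"] Inf unfolding Z_def by auto
    with Inf dw0 show False unfolding Z_def by auto
  qed
  show "u2 t \<le> u1 t" using step[of t] pos t by auto
  obtain x where x: "0 < x" "x < t" "(w2 t - w1 t) - (w2 0 - w1 0) = (t - 0) * (dw2 x - dw1 x)"
    by (rule mvt_within[of T "\<lambda>s. w2 s - w1 s" "\<lambda>s. dw2 s - dw1 s" 0 t])
       (rule DERIV_diff[OF D2(3) D1(3)], use t in auto)
  have "0 < (t - 0) * (dw2 x - dw1 x)" using pos[of x] x t by (auto intro!: mult_pos_pos)
  then show "w1 t < w2 t" using x D1(8) D2(8) by linarith
qed

text \<open>The right-hand side need not be Lipschitz at \<open>0\<close>, where \<open>u\<close> and \<open>w\<close> vanish. But there they are
  squeezed between two lines through the origin, so the quotients \<open>u t / t\<close> and \<open>w t / t\<close> stay in a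
  compact part of the open half line, on which powers are Lipschitz.\<close>

lemma powr_diff_le_between_lines:
  fixes a k x y L M N T t :: real
  assumes "0 < k" "0 \<le> a"
    and L: "\<And>x y. x \<in> {k..M} \<Longrightarrow> y \<in> {k..M} \<Longrightarrow> \<bar>x powr a - y powr a\<bar> \<le> L * \<bar>x - y\<bar>" and "0 < L"
    and t: "0 < t" "t \<le> T" and x: "k * t \<le> x" "x \<le> M * t" and y: "k * t \<le> y" "y \<le> M * t"
    and d: "\<bar>x - y\<bar> \<le> t * N"
  shows "\<bar>x powr a - y powr a\<bar> \<le> T powr a * L * N"
proof -
  have "x / t \<in> {k..M}" "y / t \<in> {k..M}" using t x y by (auto simp: field_simps)
  note Lt = L[OF this]
  have "\<bar>x / t - y / t\<bar> = \<bar>x - y\<bar> / t" using t by (simp add: abs_divide flip: diff_divide_distrib)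
  also have "\<dots> \<le> N" using d t by (simp add: field_simps)
  finally have q: "\<bar>x / t - y / t\<bar> \<le> N" .
  have "0 \<le> x" "0 \<le> y" using x y t \<open>0 < k\<close> by (smt (verit) mult_pos_pos)+
  then have "x powr a = t powr a * (x / t) powr a" "y powr a = t powr a * (y / t) powr a"
    using t by (simp_all flip: powr_mult)
  then have "\<bar>x powr a - y powr a\<bar> = t powr a * \<bar>(x / t) powr a - (y / t) powr a\<bar>"
    by (simp add: abs_mult flip: right_diff_distrib)
  also have "\<dots> \<le> T powr a * (L * N)"
  proof (rule mult_mono)
    show "t powr a \<le> T powr a" using t assms(2) by (intro powr_mono2) auto
    show "\<bar>(x / t) powr a - (y / t) powr a\<bar> \<le> L * N"
      using Lt mult_left_mono[OF q, of L] \<open>0 < L\<close> by linarith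
  qed auto
  finally show ?thesis by (simp add: mult.assoc)
qed

section \<open>Gronwall estimate and uniqueness from equal initial slopes\<close>

text \<open>Adding \<open>g\<close> to, or subtracting it from, \<open>A / K * exp (K * s)\<close>
  gives a nondecreasing function. The gain is the factor \<open>1 / K\<close>, which is made small
  in the uniqueness proof.\<close>

lemma deriv_le_exp_bound:
  fixes g :: "real \<Rightarrow> real"
  assumes g: "\<And>x. x \<in> {0..T} \<Longrightarrow> (g has_real_derivative g' x) (at x within {0..T})"
    and b: "\<And>x. 0 < x \<Longrightarrow> x < T \<Longrightarrow> \<bar>g' x\<bar> \<le> A * exp (K * x)"
    and "0 < K" "0 \<le> A" "g 0 = 0" "t \<in> {0..T}"
  shows "\<bar>g t\<bar> \<le> A / K * exp (K * t)"
proof -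
  have b1: "g' x \<le> A * exp (K * x)" "0 \<le> A * exp (K * x) + g' x" if "0 < x" "x < T" for x
    using b[OF that] unfolding abs_le_iff by linarith+
  have "A / K * exp (K * 0) - g 0 \<le> A / K * exp (K * t) - g t"
    by (rule mono_within[of T "\<lambda>s. A / K * exp (K * s) - g s" "\<lambda>s. A * exp (K * s) - g' s"])
       (use assms(3-) g b1 in \<open>auto intro!: derivative_eq_intros\<close>)
  moreover have "A / K * exp (K * 0) + g 0 \<le> A / K * exp (K * t) + g t"
    by (rule mono_within[of T "\<lambda>s. A / K * exp (K * s) + g s" "\<lambda>s. A * exp (K * s) + g' s"])
       (use assms(3-) g b1 in \<open>auto intro!: derivative_eq_intros\<close>)
  moreover have "0 \<le> A / K" using assms by simp
  ultimately show ?thesis using \<open>g 0 = 0\<close> unfolding abs_le_iff by auto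
qed

text \<open>A Gronwall argument in a supremum norm with weight \<open>exp (- K * s)\<close>.
  Positivity at \<open>T\<close> supplies the lower line through the origin, and the common initial
  slopes supply the upper one.\<close>

lemma emden_ivp_unique:
  assumes E1: "emden_ivp a b lam T u1 du1 w1 dw1" and E2: "emden_ivp a b lam T u2 du2 w2 dw2"
    and ab: "0 \<le> a" "0 \<le> b" "0 \<le> lam"
    and du0: "du1 0 = du2 0" and dw0: "dw1 0 = dw2 0"
    and T: "0 < T" and pos: "0 < u1 T" "0 < w1 T" "0 < u2 T" "0 < w2 T"
    and t: "t \<in> {0..T}"
  shows "u1 t = u2 t" and "w1 t = w2 t"
proof -
  note D1 = emden_ivpD[OF E1] and D2 = emden_ivpD[OF E2]
  \<comment> \<open>\<open>k\<close> is the smallest of the four chord slopes over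
    \<open>{0..T}\<close>, and \<open>M\<close> the larger of the two initial slopes.\<close>
  define k where "k = min (min (u1 T) (w1 T)) (min (u2 T) (w2 T)) / T"
  define M where "M = max (du1 0) (dw1 0)"
  have k: "0 < k" "k * T \<le> u1 T" "k * T \<le> u2 T" "k * T \<le> w1 T" "k * T \<le> w2 T"
    using T pos unfolding k_def by auto
  have lines: "k * s \<le> g s \<and> g s \<le> M * s"
    if "\<And>x. x \<in> {0..T} \<Longrightarrow> (g has_real_derivative g' x) (at x within {0..T})"
      and "\<And>s t. 0 \<le> s \<Longrightarrow> s \<le> t \<Longrightarrow> t \<le> T \<Longrightarrow> g' t \<le> g' s"
      and "g 0 = 0" and "s \<in> {0..T}" and "k * T \<le> g T" and "g' 0 \<le> M" for g g' s
  proof -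
    note c = concave_chord[of T g g' s, OF that(1,2,3,4)]
    have "T * (k * s) \<le> T * g s"
      using c(1) mult_left_mono[OF that(5), of s] that(4) by (simp add: algebra_simps)
    moreover have "s * g' 0 \<le> s * M" using that by (intro mult_left_mono) auto
    ultimately show ?thesis using c(2) T by (simp add: algebra_simps)
  qed
  have lu1: "k * s \<le> u1 s \<and> u1 s \<le> M * s" if "s \<in> {0..T}" for s
    by (rule lines[OF D1(1) emden_ivp_antimono(1)[OF E1 ab(3)]]) (use that D1(7) k in \<open>auto simp: M_def\<close>)
  have lw1: "k * s \<le> w1 s \<and> w1 s \<le> M * s" if "s \<in> {0..T}" for s
    by (rule lines[OF D1(3) emden_ivp_antimono(2)[OF E1 ab(3)]]) (use that D1(8) k in \<open>auto simp: M_def\<close>)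
  have lu2: "k * s \<le> u2 s \<and> u2 s \<le> M * s" if "s \<in> {0..T}" for s
    by (rule lines[OF D2(1) emden_ivp_antimono(1)[OF E2 ab(3)]]) (use that D2(7) k du0 in \<open>auto simp: M_def\<close>)
  have lw2: "k * s \<le> w2 s \<and> w2 s \<le> M * s" if "s \<in> {0..T}" for s
    by (rule lines[OF D2(3) emden_ivp_antimono(2)[OF E2 ab(3)]]) (use that D2(8) k dw0 in \<open>auto simp: M_def\<close>)
  obtain La where La: "0 < La"
    "\<And>x y. x \<in> {k..M} \<Longrightarrow> y \<in> {k..M} \<Longrightarrow> \<bar>x powr a - y powr a\<bar> \<le> La * \<bar>x - y\<bar>"
    using powr_lipschitz_on_pos[OF k(1)] by blast
  obtain Lb where Lb: "0 < Lb"
    "\<And>x y. x \<in> {k..M} \<Longrightarrow> y \<in> {k..M} \<Longrightarrow> \<bar>x powr b - y powr b\<bar> \<le> Lb * \<bar>x - y\<bar>"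
    using powr_lipschitz_on_pos[OF k(1)] by blast
  define C where "C = T powr a * La + lam * (T powr b * Lb)"
  have C: "0 < C" "0 \<le> T powr a * La" "0 \<le> lam * (T powr b * Lb)" using La Lb T ab unfolding C_def
    by (auto intro!: add_pos_nonneg mult_pos_pos)
  \<comment> \<open>\<open>C\<close> is the total Lipschitz constant. With twice that constant in
    the weight, one integration returns at most half of the weighted norm \<open>N\<close>.\<close>
  define K where "K = 2 * C"
  have K: "0 < K" using C K_def by simp
  define E where "E = (\<lambda>s. (\<bar>du1 s - du2 s\<bar> + \<bar>dw1 s - dw2 s\<bar>) * exp (- K * s))"
  have "continuous_on {0..T} E" unfolding E_def
    by (intro continuous_intros emden_ivp_continuous[OF E1] emden_ivp_continuous[OF E2])
  then obtain m where m: "m \<in> {0..T}" "\<And>s. s \<in> {0..T} \<Longrightarrow> E s \<le> E m"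
    using continuous_attains_sup[of "{0..T}" E] T by auto
  define N where "N = E m"
  have N0: "0 \<le> N" unfolding N_def E_def by simp
  have sum: "\<bar>du1 s - du2 s\<bar> + \<bar>dw1 s - dw2 s\<bar> \<le> N * exp (K * s)" if "s \<in> {0..T}" for s
  proof -
    have "\<bar>du1 s - du2 s\<bar> + \<bar>dw1 s - dw2 s\<bar> = E s * exp (K * s)"
      unfolding E_def by (simp add: mult.assoc flip: exp_add)
    then show ?thesis using m(2)[OF that] unfolding N_def by simp
  qed
  have sums: "\<bar>du1 s - du2 s\<bar> \<le> N * exp (K * s)" "\<bar>dw1 s - dw2 s\<bar> \<le> N * exp (K * s)"
    if "s \<in> {0..T}" for s
    using sum[OF that] by linarith+
  \<comment> \<open>The factor \<open>s\<close> is kept because the Lipschitz estimate is applied to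
    quotients by \<open>s\<close>.\<close>
  have diff: "\<bar>g s\<bar> \<le> s * (N * exp (K * s))"
    if g: "\<And>x. x \<in> {0..T} \<Longrightarrow> (g has_real_derivative g' x) (at x within {0..T})" and "g 0 = 0"
      and b: "\<And>x. x \<in> {0..T} \<Longrightarrow> \<bar>g' x\<bar> \<le> N * exp (K * x)" and s: "0 < s" "s \<le> T" for g g' s
  proof -
    obtain x where x: "0 < x" "x < s" "g s - g 0 = (s - 0) * g' x"
      by (rule mvt_within[of T g g' 0 s]) (use g s in auto)
    have "\<bar>g' x\<bar> \<le> N * exp (K * x)" using b s x by auto
    also have "\<dots> \<le> N * exp (K * s)" using x K N0 by (intro mult_left_mono) auto
    finally show ?thesis using x s \<open>g 0 = 0\<close> by (simp add: abs_mult)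
  qed
  have du: "\<bar>du1 s - du2 s\<bar> \<le> T powr a * La * N / K * exp (K * s)" if "s \<in> {0..T}" for s
  proof (rule deriv_le_exp_bound[of T "\<lambda>s. du1 s - du2 s" "\<lambda>s. - (w1 s powr a) - - (w2 s powr a)"])
    fix x assume x: "0 < x" "x < T"
    have "\<bar>w1 x - w2 x\<bar> \<le> x * (N * exp (K * x))"
      by (rule diff[of "\<lambda>s. w1 s - w2 s" "\<lambda>s. dw1 s - dw2 s"])
         (rule DERIV_diff[OF D1(3) D2(3)], use x D1(8) D2(8) sums(2) in auto)
    then have "\<bar>w1 x powr a - w2 x powr a\<bar> \<le> T powr a * La * (N * exp (K * x))"
      by (intro powr_diff_le_between_lines[where M=M and k=k]) (use x La k ab lw1[of x] lw2[of x] in auto)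
    then show "\<bar>- (w1 x powr a) - - (w2 x powr a)\<bar> \<le> T powr a * La * N * exp (K * x)"
      by (simp add: abs_minus_commute mult.assoc)
  qed (rule DERIV_diff[OF D1(2) D2(2)], use that K du0 mult_nonneg_nonneg[OF C(2) N0] in auto)
  have dw: "\<bar>dw1 s - dw2 s\<bar> \<le> lam * (T powr b * Lb) * N / K * exp (K * s)" if "s \<in> {0..T}" for s
  proof (rule deriv_le_exp_bound[of T "\<lambda>s. dw1 s - dw2 s" "\<lambda>s. - lam * u1 s powr b - - lam * u2 s powr b"])
    fix x assume x: "0 < x" "x < T"
    have "\<bar>u1 x - u2 x\<bar> \<le> x * (N * exp (K * x))"
      by (rule diff[of "\<lambda>s. u1 s - u2 s" "\<lambda>s. du1 s - du2 s"])
         (rule DERIV_diff[OF D1(1) D2(1)], use x D1(7) D2(7) sums(1) in auto)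
    then have "\<bar>u1 x powr b - u2 x powr b\<bar> \<le> T powr b * Lb * (N * exp (K * x))"
      by (intro powr_diff_le_between_lines[where M=M and k=k]) (use x Lb k ab lu1[of x] lu2[of x] in auto)
    then have "lam * \<bar>u1 x powr b - u2 x powr b\<bar> \<le> lam * (T powr b * Lb * (N * exp (K * x)))"
      by (intro mult_left_mono ab)
    moreover have "\<bar>- lam * u1 x powr b - - lam * u2 x powr b\<bar> = lam * \<bar>u1 x powr b - u2 x powr b\<bar>"
      using ab by (simp add: abs_mult abs_minus_commute flip: right_diff_distrib)
    ultimately show "\<bar>- lam * u1 x powr b - - lam * u2 x powr b\<bar> \<le> lam * (T powr b * Lb) * N * exp (K * x)"
      by (simp add: mult.assoc)
  qed (rule DERIV_diff[OF D1(4) D2(4)], use that K dw0 mult_nonneg_nonneg[OF C(3) N0] in auto)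
  \<comment> \<open>At the point \<open>m\<close> where the weighted norm is attained, the two slope
    estimates add up to \<open>N \<le> N / 2\<close>.\<close>
  have "N * exp (K * m) = \<bar>du1 m - du2 m\<bar> + \<bar>dw1 m - dw2 m\<bar>"
    unfolding N_def E_def by (simp add: mult.assoc flip: exp_add)
  also have "\<dots> \<le> C * N / K * exp (K * m)"
    using du[OF m(1)] dw[OF m(1)] unfolding C_def by (simp add: add_divide_distrib algebra_simps)
  also have "\<dots> = N / 2 * exp (K * m)" using C unfolding K_def by simp
  finally have "N \<le> N / 2" by (metis exp_gt_zero mult_le_cancel_right_pos)
  then have "N = 0" using N0 by simp
  have "u1 t - u2 t = 0 \<and> w1 t - w2 t = 0"
  proof (cases "t = 0")
    case False
    have "\<bar>u1 t - u2 t\<bar> \<le> t * (N * exp (K * t))"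
      by (rule diff[of "\<lambda>s. u1 s - u2 s" "\<lambda>s. du1 s - du2 s"])
         (rule DERIV_diff[OF D1(1) D2(1)], use t False D1(7) D2(7) sums(1) in auto)
    moreover have "\<bar>w1 t - w2 t\<bar> \<le> t * (N * exp (K * t))"
      by (rule diff[of "\<lambda>s. w1 s - w2 s" "\<lambda>s. dw1 s - dw2 s"])
         (rule DERIV_diff[OF D1(3) D2(3)], use t False D1(8) D2(8) sums(2) in auto)
    ultimately show ?thesis using \<open>N = 0\<close> by simp
  qed (use D1 D2 in auto)
  then show "u1 t = u2 t" and "w1 t = w2 t" by auto
qed

section \<open>Uniqueness of positive solutions\<close>

text \<open>The positive values at the midpoint lie below the tangents at \<open>0\<close>.\<close>

lemma emden_bvp_slopes_pos:
  assumes B: "emden_bvp a b lam T u du w dw" and "0 < T" "0 \<le> lam"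
  shows "0 < du 0" and "0 < dw 0"
proof -
  note D = emden_ivpD[OF emden_bvpD(1)[OF B]]
  note anti = emden_ivp_antimono[OF emden_bvpD(1)[OF B] assms(3)]
  have t: "T / 2 \<in> {0..T}" using assms by auto
  have "u (T / 2) \<le> T / 2 * du 0" by (rule concave_chord(2)[OF D(1) anti(1) D(7) t]) auto
  moreover have "0 < u (T / 2)" using assms by (intro emden_bvpD[OF B]) auto
  ultimately have "0 < T / 2 * du 0" by linarith
  then show "0 < du 0" using assms by (simp add: zero_less_mult_iff)
  have "w (T / 2) \<le> T / 2 * dw 0" by (rule concave_chord(2)[OF D(3) anti(2) D(8) t]) auto
  moreover have "0 < w (T / 2)" using assms by (intro emden_bvpD[OF B]) auto
  ultimately have "0 < T / 2 * dw 0" by linarith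
  then show "0 < dw 0" using assms by (simp add: zero_less_mult_iff)
qed

lemma emden_bvp_slope_not_less:
  assumes B1: "emden_bvp a b lam T1 u1 du1 w1 dw1" and B2: "emden_bvp a b lam T2 u2 du2 w2 dw2"
    and ab: "0 \<le> a" "0 \<le> b" "0 \<le> lam" and T: "0 < T1" "0 < T2" and du0: "du1 0 = du2 0"
  shows "\<not> dw1 0 < dw2 0"
proof
  assume dw0: "dw1 0 < dw2 0"
  note I1 = emden_bvpD(1)[OF B1] and I2 = emden_bvpD(1)[OF B2]
  define T where "T = min T1 T2"
  have "emden_ivp a b lam T u1 du1 w1 dw1" "emden_ivp a b lam T u2 du2 w2 dw2"
    using emden_ivp_subinterval[OF I1] emden_ivp_subinterval[OF I2] by (auto simp: T_def)
  note cmp = emden_ivp_skew_comparison[OF this ab du0 dw0]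
  show False
  \<comment> \<open>If the first solution ends strictly earlier, \<open>u1\<close> vanishes where
    \<open>u2\<close> is still positive. Otherwise, equal lengths included, the strict inequality
    for \<open>w\<close> contradicts \<open>w2 T2 = 0\<close>.\<close>
  proof (cases "T1 < T2")
    case True
    have "u2 T1 \<le> u1 T1" by (rule cmp) (use True T in \<open>auto simp: T_def\<close>)
    moreover have "0 < u2 T1" using True T by (intro emden_bvpD[OF B2])
    ultimately show ?thesis using emden_bvpD(2)[OF B1] by simp
  next
    case False
    have "w1 T2 < w2 T2" by (rule cmp) (use False T in \<open>auto simp: T_def\<close>)
    moreover have "0 \<le> w1 T2" using False T by (intro emden_ivpD(6)[OF I1]) auto
    ultimately show ?thesis using emden_bvpD(3)[OF B2] by simp
  qed
qed

text \<open>Uniqueness for the initial value problem asks for positive values at the right end, so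
  it is applied on \<open>{0..t}\<close> with \<open>t < T1\<close>; continuity then reaches
  \<open>T1\<close>. A longer second solution would be positive at \<open>T1\<close>, where the
  first one vanishes.\<close>

lemma emden_bvp_unique_same_slopes:
  assumes B1: "emden_bvp a b lam T1 u1 du1 w1 dw1" and B2: "emden_bvp a b lam T2 u2 du2 w2 dw2"
    and ab: "0 \<le> a" "0 \<le> b" "0 \<le> lam" and T: "0 < T1" "T1 \<le> T2"
    and du0: "du1 0 = du2 0" and dw0: "dw1 0 = dw2 0"
  shows "T1 = T2" and "\<And>t. t \<in> {0..T1} \<Longrightarrow> u1 t = u2 t"
proof -
  note I1 = emden_bvpD(1)[OF B1] and I2 = emden_bvpD(1)[OF B2]
  have eq: "u1 t - u2 t = 0" if "t \<in> {0<..<T1}" for t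
  proof -
    have t: "0 < t" "t < T1" "t \<le> T1" "t < T2" "t \<le> T2" "t \<in> {0..t}" using that T by auto
    have "u1 t = u2 t"
      by (rule emden_ivp_unique[OF emden_ivp_subinterval[OF I1 t(3)] emden_ivp_subinterval[OF I2 t(5)]
            ab du0 dw0 t(1) emden_bvpD(4,5)[OF B1 t(1,2)] emden_bvpD(4,5)[OF B2 t(1,4)] t(6)])
    then show ?thesis by simp
  qed
  have cl: "closure {0<..<T1} = {0..T1}" using T by simp
  have "continuous_on (closure {0<..<T1}) (\<lambda>t. u1 t - u2 t)"
    unfolding cl using emden_ivp_continuous(1)[OF I1] emden_ivp_continuous(1)[OF I2] T
    by (auto intro!: continuous_on_diff elim: continuous_on_subset)
  from continuous_constant_on_closure[OF this eq]
  have E: "u1 t = u2 t" if "t \<in> {0..T1}" for t using that unfolding cl by simp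
  show "u1 t = u2 t" if "t \<in> {0..T1}" for t by (rule E[OF that])
  show "T1 = T2"
  proof (rule ccontr)
    assume "T1 \<noteq> T2"
    then have "0 < u2 T1" using T by (intro emden_bvpD[OF B2]) auto
    then show False using E[of T1] T emden_bvpD(2)[OF B1] by simp
  qed
qed

lemma emden_bvp_unique_same_slope:
  assumes B1: "emden_bvp a b lam T1 u1 du1 w1 dw1" and B2: "emden_bvp a b lam T2 u2 du2 w2 dw2"
    and ab: "0 \<le> a" "0 \<le> b" "0 \<le> lam" and T: "0 < T1" "0 < T2" and du0: "du1 0 = du2 0"
  shows "T1 = T2" and "\<And>t. t \<in> {0..T1} \<Longrightarrow> u1 t = u2 t"
proof -
  have dw0: "dw1 0 = dw2 0"
    using emden_bvp_slope_not_less[OF B1 B2 ab T du0]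
      emden_bvp_slope_not_less[OF B2 B1 ab T(2,1) du0[symmetric]] by simp
  show TT: "T1 = T2"
  proof (cases "T1 \<le> T2")
    case True
    show ?thesis by (rule emden_bvp_unique_same_slopes(1)[OF B1 B2 ab T(1) True du0 dw0])
  next
    case False
    then show ?thesis
      using emden_bvp_unique_same_slopes(1)[OF B2 B1 ab T(2) _ du0[symmetric] dw0[symmetric]] by simp
  qed
  show "u1 t = u2 t" if "t \<in> {0..T1}" for t
    by (rule emden_bvp_unique_same_slopes(2)[OF B1 B2 ab T(1) _ du0 dw0 that]) (simp add: TT)
qed

section \<open>Scaling of time and amplitudes\<close>

text \<open>Two derivatives bring out \<open>s\<^sup>2\<close>, and powers are multiplicative. The
  two equations for \<open>c\<close>, \<open>d\<close>, \<open>s\<close> match the resulting factors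
  in the two differential equations.\<close>

lemma emden_bvp_scale:
  assumes B: "emden_bvp a b lam T u du w dw" and pos: "0 < c" "0 < d" "0 < s" "0 < T"
    and c: "c * s\<^sup>2 = d powr a" and d: "d * s\<^sup>2 * lam = lam' * c powr b"
  shows "emden_bvp a b lam' (T / s) (\<lambda>t. c * u (s * t)) (\<lambda>t. c * s * du (s * t))
           (\<lambda>t. d * w (s * t)) (\<lambda>t. d * s * dw (s * t))"
proof -
  note D = emden_ivpD[OF emden_bvpD(1)[OF B]]
  have im: "(\<lambda>t. s * t) ` {0..T / s} = {0..T}" using pos by (simp add: image_mult_atLeastAtMost)
  have dom: "s * t \<in> {0..T}" if "t \<in> {0..T / s}" for t using im that by blast
  have chain: "((\<lambda>t. k * g (s * t)) has_real_derivative k * s * g' (s * t)) (at t within {0..T / s})"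
    if g: "\<And>x. x \<in> {0..T} \<Longrightarrow> (g has_real_derivative g' x) (at x within {0..T})"
      and t: "t \<in> {0..T / s}" for g g' k t
  proof -
    have "(g has_real_derivative g' (s * t)) (at (s * t) within (\<lambda>t. s * t) ` {0..T / s})"
      unfolding im by (rule g[OF dom[OF t]])
    from DERIV_image_chain[OF this, of s]
    have "(g \<circ> (\<lambda>t. s * t) has_real_derivative g' (s * t) * s) (at t within {0..T / s})"
      by (auto intro!: derivative_eq_intros)
    from DERIV_cmult[OF this, of k] show ?thesis by (simp add: o_def mult.assoc mult.commute)
  qed
  have "((\<lambda>t. c * s * du (s * t)) has_real_derivative - ((d * w (s * t)) powr a)) (at t within {0..T / s})"
    if t: "t \<in> {0..T / s}" for t
  proof -
    have "(d * w (s * t)) powr a = d powr a * w (s * t) powr a"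
      by (rule powr_mult)
    also have "\<dots> = c * s * s * w (s * t) powr a" by (simp add: power2_eq_square flip: c)
    finally show ?thesis using chain[OF D(2) t, of "c * s"] by simp
  qed
  moreover have "((\<lambda>t. d * s * dw (s * t)) has_real_derivative - lam' * (c * u (s * t)) powr b)
      (at t within {0..T / s})" if t: "t \<in> {0..T / s}" for t
  proof -
    have "lam' * (c * u (s * t)) powr b = (lam' * c powr b) * u (s * t) powr b"
      by (simp add: powr_mult)
    also have "\<dots> = d * s * s * (lam * u (s * t) powr b)" by (simp add: power2_eq_square flip: d)
    finally show ?thesis using chain[OF D(4) t, of "d * s"] by simp
  qed
  moreover have "s * t \<in> {0<..<T}" if "t \<in> {0<..<T / s}" for t
    using that pos by (auto simp: field_simps)
  ultimately show ?thesis
    unfolding emden_bvp_def emden_ivp_def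
    using chain[OF D(1)] chain[OF D(3)] D(5-8) dom emden_bvpD(2-5)[OF B] pos by simp
qed

text \<open>Taking logarithms makes the three equations linear in \<open>ln c\<close>,
  \<open>ln d\<close>, \<open>ln s\<close>. Eliminating the first two leaves the coefficient
  \<open>1 / a + 2 + b\<close> of \<open>ln s\<close>, which is positive even when
  \<open>a * b = 1\<close>.\<close>

lemma scaling_factors_exist:
  fixes a b l1 l2 r :: real
  assumes "0 < a" "0 < b" "0 < l1" "0 < l2" "0 < r"
  obtains c d s where "0 < c" "0 < d" "0 < s" "c * s\<^sup>2 = d powr a" "d * s\<^sup>2 * l1 = l2 * c powr b" "c * s = r"
proof -
  define A where "A = ln r"
  define \<sigma> where "\<sigma> = (b * A - A / a - (ln l1 - ln l2)) / (1 / a + 2 + b)"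
  define \<gamma> where "\<gamma> = A - \<sigma>"
  define \<delta> where "\<delta> = (A + \<sigma>) / a"
  have "0 < 1 / a + 2 + b" using assms by (simp add: add_pos_pos)
  then have "\<sigma> * (1 / a + 2 + b) = b * A - A / a - (ln l1 - ln l2)" unfolding \<sigma>_def by simp
  then have 1: "\<delta> + 2 * \<sigma> + ln l1 = ln l2 + b * \<gamma>"
    unfolding \<gamma>_def \<delta>_def by (simp add: algebra_simps add_divide_distrib)
  have 2: "\<gamma> + 2 * \<sigma> = a * \<delta>" unfolding \<gamma>_def \<delta>_def using assms by simp
  show ?thesis
  proof (rule that)
    show "exp \<gamma> * (exp \<sigma>)\<^sup>2 = exp \<delta> powr a"
      using arg_cong[OF 2, of exp] by (simp add: powr_def exp_add exp_double)
    show "exp \<delta> * (exp \<sigma>)\<^sup>2 * l1 = l2 * exp \<gamma> powr b"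
      using arg_cong[OF 1, of exp] assms by (simp add: powr_def exp_add exp_double)
    show "exp \<gamma> * exp \<sigma> = r" using assms unfolding \<gamma>_def A_def by (simp flip: exp_add)
  qed auto
qed

text \<open>The first solution is scaled to the eigenvalue and initial slope of the second. The
  lengths \<open>T / s\<close> and \<open>T\<close> must then agree, so \<open>s = 1\<close> and
  only amplitudes remain. Two eigenvalues are allowed, so that the eigenvalue itself can be compared
  when \<open>p = q\<close>.\<close>

lemma emden_bvp_unique:
  assumes B1: "emden_bvp a b l1 T u1 du1 w1 dw1" and B2: "emden_bvp a b l2 T u2 du2 w2 dw2"
    and pos: "0 < a" "0 < b" "0 < l1" "0 < l2" "0 < T"
  obtains c d where "0 < c" "0 < d" "c = d powr a" "d * l1 = l2 * c powr b"
    "\<And>t. t \<in> {0..T} \<Longrightarrow> u2 t = c * u1 t"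
proof -
  have du: "0 < du1 0" "0 < du2 0"
    using emden_bvp_slopes_pos(1)[OF B1] emden_bvp_slopes_pos(1)[OF B2] pos by auto
  then have "0 < du2 0 / du1 0" by simp
  from scaling_factors_exist[OF pos(1-4) this] obtain c d s where
    cds: "0 < c" "0 < d" "0 < s" "c * s\<^sup>2 = d powr a" "d * s\<^sup>2 * l1 = l2 * c powr b"
    and cs: "c * s = du2 0 / du1 0" .
  note S = emden_bvp_scale[OF B1 cds(1-3) pos(5) cds(4,5)]
  have "T / s = T" and eq: "\<And>t. t \<in> {0..T / s} \<Longrightarrow> c * u1 (s * t) = u2 t"
    using emden_bvp_unique_same_slope[OF S B2] pos cds cs du by auto
  then have "s = 1" using pos cds by (simp add: field_simps)
  show ?thesis
    by (rule that[of c d]) (use cds eq \<open>s = 1\<close> in auto)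
qed

section \<open>Positive eigenpairs\<close>

lemma signed_pow_nonneg: "0 \<le> x \<Longrightarrow> signed_pow r x = x powr (r - 1)"
  by (cases "x = 0") (auto simp: signed_pow_def)

lemma signed_pow_minus: "signed_pow r (- x) = - signed_pow r x"
  by (simp add: signed_pow_def)

lemma conj_exponent_minus_one: "1 < p \<Longrightarrow> conj_exponent p - 1 = 1 / (p - 1)"
  by (simp add: conj_exponent_def field_simps)

text \<open>Positivity of \<open>w\<close> comes from that of \<open>u\<close>: \<open>w\<close>
  vanishes at both ends and has a negative second derivative in between. Hence the signed powers are
  ordinary powers.\<close>

lemma positive_eigenpair_imp_emden_bvp:
  assumes p: "1 < p" and T: "0 < T" and P: "positive_eigenpair p q T u lam"
  shows "0 < lam" and "\<exists>du w dw. emden_bvp (1 / (p - 1)) (q - 1) lam T u du w dw"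
proof -
  show lam: "0 < lam" using P unfolding positive_eigenpair_def eigenpair_def by simp
  obtain du ddu w dw where
    u: "has_C1_deriv_on T u du" and du: "has_C1_deriv_on T du ddu"
    and w_eq: "\<And>t. t \<in> {0..T} \<Longrightarrow> w t = - signed_pow p (ddu t)"
    and ddu_eq: "\<And>t. t \<in> {0..T} \<Longrightarrow> ddu t = - signed_pow (conj_exponent p) (w t)"
    and w: "has_C1_deriv_on T w dw" and dw: "has_C1_deriv_on T dw (\<lambda>t. - lam * signed_pow q (u t))"
    and ends: "u 0 = 0" "u T = 0" "ddu 0 = 0" "ddu T = 0"
    using P unfolding positive_eigenpair_def eigenpair_def solves_E_def by blast
  have upos: "0 < u t" if "0 < t" "t < T" for t
    using that P unfolding positive_eigenpair_def by auto
  have u0: "0 \<le> u t" if "t \<in> {0..T}" for t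
    using that upos[of t] ends by (cases "t = 0 \<or> t = T") auto
  have dw': "(dw has_real_derivative - lam * u t powr (q - 1)) (at t within {0..T})" if "t \<in> {0..T}" for t
    using dw that signed_pow_nonneg[OF u0[OF that], of q] unfolding has_C1_deriv_on_def by metis
  have w': "(w has_real_derivative dw t) (at t within {0..T})" if "t \<in> {0..T}" for t
    using w that unfolding has_C1_deriv_on_def by auto
  have wend: "w 0 = 0" "w T = 0" using w_eq[of 0] w_eq[of T] ends T by (auto simp: signed_pow_def)
  have wpos: "0 < w t" if "0 < t" "t < T" for t
  proof (rule concave_pos[OF w' dw' _ wend that])
    show "- lam * u x powr (q - 1) < 0" if "0 < x" "x < T" for x
      using upos[OF that] lam by simp
  qed
  have w0: "0 \<le> w t" if "t \<in> {0..T}" for t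
    using that wpos[of t] wend by (cases "t = 0 \<or> t = T") auto
  have du': "(du has_real_derivative - (w t powr (1 / (p - 1)))) (at t within {0..T})" if "t \<in> {0..T}" for t
  proof -
    have "ddu t = - (w t powr (1 / (p - 1)))"
      using ddu_eq[OF that] w0[OF that] p by (simp add: signed_pow_nonneg conj_exponent_minus_one)
    then show ?thesis using du that unfolding has_C1_deriv_on_def by metis
  qed
  have "emden_bvp (1 / (p - 1)) (q - 1) lam T u du w dw"
    unfolding emden_bvp_def emden_ivp_def
    using u du' w' dw' ends wend upos wpos u0 w0 unfolding has_C1_deriv_on_def by simp
  then show "\<exists>du w dw. emden_bvp (1 / (p - 1)) (q - 1) lam T u du w dw" by blast
qed

lemma emden_bvp_imp_positive_eigenpair:
  assumes pq: "1 < p" "1 < q" and T: "0 < T" and lam: "0 < lam"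
    and B: "emden_bvp (1 / (p - 1)) (q - 1) lam T u du w dw"
  shows "positive_eigenpair p q T u lam"
proof -
  define a where "a = 1 / (p - 1)"
  have a: "0 < a" "a * (p - 1) = 1" using pq by (auto simp: a_def)
  note I = emden_bvpD(1)[OF B[folded a_def]]
  note D = emden_ivpD[OF I]
  note cont = emden_ivp_continuous[OF I]
  have "continuous_on {0..T} (\<lambda>t. w t powr a)" "continuous_on {0..T} (\<lambda>t. u t powr (q - 1))"
    using a pq D(5,6) by (auto intro!: continuous_on_powr' cont)
  moreover have "continuous_on {0..T} (\<lambda>t. signed_pow q (u t))
      \<longleftrightarrow> continuous_on {0..T} (\<lambda>t. u t powr (q - 1))"
    using D(5) by (intro continuous_on_cong) (auto simp: signed_pow_nonneg)
  ultimately have c: "continuous_on {0..T} (\<lambda>t. - (w t powr a))"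
    "continuous_on {0..T} (\<lambda>t. - lam * signed_pow q (u t))"
    by (auto intro!: continuous_intros)
  have "has_C1_deriv_on T u du" "has_C1_deriv_on T du (\<lambda>t. - (w t powr a))" "has_C1_deriv_on T w dw"
    "has_C1_deriv_on T dw (\<lambda>t. - lam * signed_pow q (u t))"
    unfolding has_C1_deriv_on_def using D(1-5) cont c by (simp_all add: signed_pow_nonneg)
  \<comment> \<open>\<open>a * (p - 1) = 1\<close> makes the two powers inverse to each
    other.\<close>
  moreover have "w t = - signed_pow p (- (w t powr a))" if "t \<in> {0..T}" for t
    using D(6)[OF that] a by (simp add: signed_pow_minus signed_pow_nonneg powr_powr)
  moreover have "- (w t powr a) = - signed_pow (conj_exponent p) (w t)" if "t \<in> {0..T}" for t
    using D(6)[OF that] pq by (simp add: signed_pow_nonneg conj_exponent_minus_one a_def)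
  ultimately have "solves_E p q T lam u"
    unfolding solves_E_def using D(7,8) emden_bvpD(2,3)[OF B]
    by (intro exI[of _ du] exI[of _ "\<lambda>t. - (w t powr a)"] exI[of _ w] exI[of _ dw]) auto
  moreover have "\<exists>t\<in>{0..T}. u t \<noteq> 0"
    using emden_bvpD(4)[OF B, of "T / 2"] T by (intro bexI[of _ "T / 2"]) auto
  ultimately show ?thesis
    unfolding positive_eigenpair_def eigenpair_def using emden_bvpD(4)[OF B] lam by auto
qed

section \<open>Normalised profiles on the half interval\<close>

text \<open>\<open>green f\<close> solves \<open>- u'' = f\<close> with \<open>u' 0 = 0\<close> and \<open>u 1 = 0\<close>.\<close>

definition green :: "(real \<Rightarrow> real) \<Rightarrow> real \<Rightarrow> real" where
  "green f t = integral {t..1} (\<lambda>s. integral {0..s} f)"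

text \<open>\<open>ratio_le g f\<close> is the statement that \<open>g / f\<close> is nonincreasing, with denominators cleared.\<close>

definition ratio_le :: "(real \<Rightarrow> real) \<Rightarrow> (real \<Rightarrow> real) \<Rightarrow> bool" where
  "ratio_le g f \<longleftrightarrow> (\<forall>s t. 0 \<le> s \<longrightarrow> s \<le> t \<longrightarrow> t \<le> 1 \<longrightarrow> g t * f s \<le> g s * f t)"

text \<open>The cross inequality is integrated over \<open>y\<close> to the right of
  \<open>b\<close> and then over \<open>x\<close> to its left.\<close>

lemma integral_cross_mono:
  fixes f g :: "real \<Rightarrow> real"
  assumes f: "f integrable_on {a..c}" and g: "g integrable_on {a..c}" and ab: "a \<le> b" "b \<le> c"
    and cross: "\<And>x y. a \<le> x \<Longrightarrow> x \<le> b \<Longrightarrow> b \<le> y \<Longrightarrow> y \<le> c \<Longrightarrow> g y * f x \<le> g x * f y"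
  shows "integral {b..c} g * integral {a..b} f \<le> integral {a..b} g * integral {b..c} f"
proof -
  have ints: "f integrable_on {a..b}" "f integrable_on {b..c}" "g integrable_on {a..b}" "g integrable_on {b..c}"
    using f g ab by (auto intro: integrable_subinterval_real)
  have "integral {b..c} g * f x \<le> g x * integral {b..c} f" if x: "x \<in> {a..b}" for x
  proof -
    have "integral {b..c} (\<lambda>y. g y * f x) \<le> integral {b..c} (\<lambda>y. g x * f y)"
      by (rule integral_le) (use ints x cross in \<open>auto intro: integrable_on_mult_right integrable_on_mult_left\<close>)
    then show ?thesis by simp
  qed
  then have "integral {a..b} (\<lambda>x. integral {b..c} g * f x) \<le> integral {a..b} (\<lambda>x. g x * integral {b..c} f)"
    by (intro integral_le) (use ints in \<open>auto intro: integrable_on_mult_right integrable_on_mult_left\<close>)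
  then show ?thesis by simp
qed

lemma continuous_on_primitive:
  fixes f :: "real \<Rightarrow> real"
  assumes "f integrable_on {0..1}"
  shows "continuous_on {0..1} (\<lambda>s. integral {0..s} f)" and "(\<lambda>s. integral {0..s} f) integrable_on {0..1}"
  using indefinite_integral_continuous_1[OF assms] integrable_continuous_real by auto

lemma integral_split:
  fixes f :: "real \<Rightarrow> real"
  assumes "f integrable_on {0..1}" "0 \<le> s" "s \<le> t" "t \<le> r" "r \<le> 1"
  shows "integral {s..r} f = integral {s..t} f + integral {t..r} f"
  using Henstock_Kurzweil_Integration.integral_combine[of s t r f] assms
  by (metis atLeastatMost_subset_iff integrable_subinterval_real order.trans)

text \<open>Integrating twice a quotient order, first from the left end and then from the right end, is the
  monotone form of l'Hospital's rule.\<close>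

lemma ratio_le_green:
  assumes f: "f integrable_on {0..1}" and g: "g integrable_on {0..1}" and fg: "ratio_le g f"
  shows "ratio_le (green g) (green f)"
proof -
  define F where "F = (\<lambda>s. integral {0..s} f)"
  define G where "G = (\<lambda>s. integral {0..s} g)"
  have FG: "F integrable_on {0..1}" "G integrable_on {0..1}"
    using continuous_on_primitive(2)[OF f] continuous_on_primitive(2)[OF g] unfolding F_def G_def by auto
  \<comment> \<open>Splitting the primitives at \<open>s\<close> leaves the term
    \<open>G s * F s\<close> on both sides, where it cancels. The second integration is treated
    alike, with a split at \<open>t\<close>.\<close>
  have 1: "G t * F s \<le> G s * F t" if st: "0 \<le> s" "s \<le> t" "t \<le> 1" for s t
  proof -
    have "integral {s..t} g * integral {0..s} f \<le> integral {0..s} g * integral {s..t} f"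
      by (rule integral_cross_mono)
         (use st f g fg in \<open>auto simp: ratio_le_def intro: integrable_subinterval_real\<close>)
    then show ?thesis
      using integral_split[OF f, of 0 s t] integral_split[OF g, of 0 s t] st
      unfolding F_def G_def by (simp add: algebra_simps)
  qed
  have "green g t * green f s \<le> green g s * green f t" if st: "0 \<le> s" "s \<le> t" "t \<le> 1" for s t
  proof -
    have "integral {t..1} G * integral {s..t} F \<le> integral {s..t} G * integral {t..1} F"
      by (rule integral_cross_mono) (use st FG 1 in \<open>auto intro: integrable_subinterval_real\<close>)
    then show ?thesis
      using integral_split[OF FG(1), of s t 1] integral_split[OF FG(2), of s t 1] st
      unfolding green_def F_def[symmetric] G_def[symmetric] by (simp add: algebra_simps)
  qed
  then show ?thesis unfolding ratio_le_def by simp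
qed

section \<open>Elementary properties of the Green operator\<close>

lemma green_one [simp]: "green f 1 = 0"
  by (simp add: green_def)

text \<open>The inner primitive is continuous as soon as \<open>f\<close> is integrable, so the
  fundamental theorem applies to the outer integral. Integrability is what is known at first of the
  powers of limit profiles.\<close>

lemma green_deriv:
  assumes f: "f integrable_on {0..1}" and t: "t \<in> {0..1}"
  shows "(green f has_real_derivative - integral {0..t} f) (at t within {0..1})"
proof -
  note F = continuous_on_primitive[OF f]
  have "((\<lambda>t. green f 0 - integral {0..t} (\<lambda>s. integral {0..s} f)) has_real_derivative 0 - integral {0..t} f)
      (at t within {0..1})"
    by (intro DERIV_diff DERIV_const integral_has_real_derivative[OF F(1) t])
  moreover have "green f 0 - integral {0..t} (\<lambda>s. integral {0..s} f) = green f t" if "t \<in> {0..1}" for t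
    using integral_split[OF F(2), of 0 t 1] that by (simp add: green_def)
  ultimately show ?thesis
    using has_field_derivative_transform_within[OF _ zero_less_one t, of _ _ "green f"] by auto
qed

lemma green_continuous: "f integrable_on {0..1} \<Longrightarrow> continuous_on {0..1} (green f)"
  by (rule DERIV_continuous_on) (rule green_deriv)

lemma primitive_mono:
  fixes f :: "real \<Rightarrow> real"
  assumes f: "f integrable_on {0..1}" and nn: "\<And>x. x \<in> {0..1} \<Longrightarrow> 0 \<le> f x"
    and st: "0 \<le> s" "s \<le> t" "t \<le> 1"
  shows "integral {0..s} f \<le> integral {0..t} f"
proof -
  have "0 \<le> integral {s..t} f"
    using st nn by (intro integral_nonneg integrable_subinterval_real[OF f]) auto
  then show ?thesis using integral_split[OF f, of 0 s t] st by simp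
qed

lemma green_antimono:
  assumes f: "f integrable_on {0..1}" and nn: "\<And>x. x \<in> {0..1} \<Longrightarrow> 0 \<le> f x"
    and st: "0 \<le> s" "s \<le> t" "t \<le> 1"
  shows "green f t \<le> green f s"
proof (rule antimono_within[OF green_deriv[OF f]])
  show "- integral {0..x} f \<le> 0" if "0 < x" "x < 1" for x
    using primitive_mono[OF f nn, of 0 x] that by simp
qed (use st in auto)

text \<open>This is the chord bound for a concave function vanishing at \<open>1\<close>. It
  compares the means of the nondecreasing primitive over \<open>{0..t}\<close> and
  \<open>{t..1}\<close>, as \<open>integral_cross_mono\<close> does against the constant
  \<open>1\<close>.\<close>

lemma green_ge:
  assumes f: "f integrable_on {0..1}" and nn: "\<And>x. x \<in> {0..1} \<Longrightarrow> 0 \<le> f x" and t: "t \<in> {0..1}"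
  shows "(1 - t) * green f 0 \<le> green f t"
proof -
  define F where "F = (\<lambda>s. integral {0..s} f)"
  have F: "F integrable_on {0..1}" using continuous_on_primitive(2)[OF f] unfolding F_def .
  have "integral {t..1} (\<lambda>_. 1) * integral {0..t} F \<le> integral {0..t} (\<lambda>_. 1) * integral {t..1} F"
    by (rule integral_cross_mono) (use t F primitive_mono[OF f nn] in \<open>auto simp: F_def\<close>)
  then have "(1 - t) * integral {0..t} F \<le> t * integral {t..1} F" using t by simp
  then show ?thesis
    using integral_split[OF F, of 0 t 1] t unfolding green_def F_def[symmetric] by (simp add: algebra_simps)
qed

text \<open>The primitive is positive at \<open>1/2\<close> and does not decrease afterwards. The
  lower bound is asked on half of the interval because profiles may vanish at
  \<open>1\<close>.\<close>

lemma green_pos: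
  fixes f :: "real \<Rightarrow> real"
  assumes f: "f integrable_on {0..1}" and nn: "\<And>x. x \<in> {0..1} \<Longrightarrow> 0 \<le> f x"
    and k: "0 < k" "\<And>x. x \<in> {0..1/2} \<Longrightarrow> k \<le> f x"
  shows "0 < green f 0"
proof -
  define F where "F = (\<lambda>s. integral {0..s} f)"
  have F: "F integrable_on {0..1}" using continuous_on_primitive(2)[OF f] unfolding F_def .
  have mono: "F s \<le> F t" if "0 \<le> s" "s \<le> t" "t \<le> 1" for s t
    using primitive_mono[OF f nn that] unfolding F_def by simp
  have "integral {0..1/2::real} (\<lambda>_. k) \<le> integral {0..1/2} f"
    by (rule integral_le) (use k integrable_subinterval_real[OF f] in auto)
  then have h: "0 < F (1/2)" using k unfolding F_def by simp
  have "integral {1/2..1::real} (\<lambda>_. F (1/2)) \<le> integral {1/2..1} F"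
    by (rule integral_le) (use integrable_subinterval_real[OF F] mono in auto)
  then have "0 < integral {1/2..1} F" using h by simp
  moreover have "0 \<le> integral {0..1/2} F"
    using mono[of 0] by (intro integral_nonneg integrable_subinterval_real[OF F]) (auto simp: F_def)
  ultimately show ?thesis
    using integral_split[OF F, of 0 "1/2" 1] unfolding green_def F_def[symmetric] by simp
qed

text \<open>Dominated convergence is used for the inner integrals and again for the outer one; the
  constant \<open>1\<close> dominates both because the interval has length one.\<close>

lemma green_tendsto:
  fixes f :: "nat \<Rightarrow> real \<Rightarrow> real"
  assumes f: "\<And>n. f n integrable_on {0..1}"
    and le: "\<And>n x. x \<in> {0..1} \<Longrightarrow> \<bar>f n x\<bar> \<le> 1"
    and lim: "\<And>x. x \<in> {0..1} \<Longrightarrow> (\<lambda>n. f n x) \<longlonglongrightarrow> g x"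
  shows "g integrable_on {0..1}" and "t \<in> {0..1} \<Longrightarrow> (\<lambda>n. green (f n) t) \<longlonglongrightarrow> green g t"
proof -
  show "g integrable_on {0..1}"
    by (rule dominated_convergence(1)[where f = f and h = "\<lambda>_. 1"]) (use f le lim in auto)
  have F: "(\<lambda>n. integral {0..s} (f n)) \<longlonglongrightarrow> integral {0..s} g" if "s \<in> {0..1}" for s
    by (rule dominated_convergence(2)[where f = f and h = "\<lambda>_. 1"])
       (use that le lim in \<open>auto intro: integrable_subinterval_real[OF f]\<close>)
  have bound: "\<bar>integral {0..s} (f n)\<bar> \<le> 1" if "s \<in> {0..1}" for s n
  proof -
    have "norm (integral {0..s} (f n)) \<le> integral {0..s} (\<lambda>_. 1)"
      by (rule integral_norm_bound_integral) (use that le in \<open>auto intro: integrable_subinterval_real[OF f]\<close>)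
    then show ?thesis using that by simp
  qed
  show "(\<lambda>n. green (f n) t) \<longlonglongrightarrow> green g t" if "t \<in> {0..1}"
    unfolding green_def
    by (rule dominated_convergence(2)[where h = "\<lambda>_. 1"])
       (use that F bound in \<open>auto intro: integrable_subinterval_real[OF continuous_on_primitive(2)[OF f]]\<close>)
qed

section \<open>The normalised iteration and its limit\<close>

text \<open>The lower bound is the chord of a concave function with value \<open>1\<close> at the
  centre. It survives pointwise limits and keeps them from degenerating.\<close>

definition profile :: "(real \<Rightarrow> real) \<Rightarrow> bool" where
  "profile f \<longleftrightarrow> f 0 = 1 \<and> (\<forall>t\<in>{0..1}. 1 - t \<le> f t \<and> f t \<le> 1)"

definition profile_step :: "real \<Rightarrow> (real \<Rightarrow> real) \<Rightarrow> real \<Rightarrow> real" where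
  "profile_step a f t = green (\<lambda>s. f s powr a) t / green (\<lambda>s. f s powr a) 0"

lemma profileD:
  assumes "profile f"
  shows "f 0 = 1" and "\<And>t. t \<in> {0..1} \<Longrightarrow> 1 - t \<le> f t" and "\<And>t. t \<in> {0..1} \<Longrightarrow> f t \<le> 1"
    and "\<And>t. t \<in> {0..1} \<Longrightarrow> 0 \<le> f t"
proof -
  show b: "1 - t \<le> f t" "f t \<le> 1" if "t \<in> {0..1}" for t
    using assms that unfolding profile_def by auto
  show "0 \<le> f t" if "t \<in> {0..1}" for t using b(1)[OF that] that by auto
  show "f 0 = 1" using assms unfolding profile_def by auto
qed

lemma profile_powr_integrable:
  assumes "profile f" "continuous_on {0..1} f" "0 < a"
  shows "(\<lambda>s. f s powr a) integrable_on {0..1}"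
  using assms profileD(4)[OF assms(1)]
  by (intro integrable_continuous_real continuous_on_powr') auto

lemma profile_green_pos:
  assumes f: "profile f" and a: "0 < a" and "(\<lambda>s. f s powr a) integrable_on {0..1}"
  shows "0 < green (\<lambda>s. f s powr a) 0"
proof (rule green_pos[where k = "(1/2) powr a"])
  show "(1/2) powr a \<le> f x powr a" if "x \<in> {0..1/2}" for x
    using profileD(2)[OF f, of x] that a by (intro powr_mono2) auto
qed (use assms in auto)

lemma profile_step_profile:
  assumes f: "profile f" "continuous_on {0..1} f" and a: "0 < a"
  shows "profile (profile_step a f)" and "continuous_on {0..1} (profile_step a f)"
    and "0 \<le> s \<Longrightarrow> s \<le> t \<Longrightarrow> t \<le> 1 \<Longrightarrow> profile_step a f t \<le> profile_step a f s"
proof -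
  note int = profile_powr_integrable[OF f a]
  note pos = profile_green_pos[OF f(1) a int]
  have anti: "green (\<lambda>s. f s powr a) t \<le> green (\<lambda>s. f s powr a) s" if "0 \<le> s" "s \<le> t" "t \<le> 1" for s t
    by (rule green_antimono[OF int _ that]) auto
  have ge: "(1 - t) * green (\<lambda>s. f s powr a) 0 \<le> green (\<lambda>s. f s powr a) t" if "t \<in> {0..1}" for t
    by (rule green_ge[OF int _ that]) auto
  show "profile (profile_step a f)"
    unfolding profile_def profile_step_def using pos anti[of 0] ge by (auto simp: pos_le_divide_eq)
  show "continuous_on {0..1} (profile_step a f)"
    unfolding profile_step_def using pos by (intro continuous_intros green_continuous[OF int]) auto
  show "profile_step a f t \<le> profile_step a f s" if "0 \<le> s" "s \<le> t" "t \<le> 1"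
    unfolding profile_step_def using pos anti[OF that] by (simp add: divide_right_mono)
qed

text \<open>Powers preserve the quotient order, \<open>green\<close> preserves it by
  \<open>ratio_le_green\<close>, and the normalising denominators are positive constants.\<close>

lemma profile_step_mono:
  assumes f: "profile f" "continuous_on {0..1} f" and g: "profile g" "continuous_on {0..1} g"
    and a: "0 < a" and fg: "ratio_le g f"
  shows "ratio_le (profile_step a g) (profile_step a f)"
proof -
  note intf = profile_powr_integrable[OF f a] and intg = profile_powr_integrable[OF g a]
  note posf = profile_green_pos[OF f(1) a intf] and posg = profile_green_pos[OF g(1) a intg]
  have "g t powr a * f s powr a \<le> g s powr a * f t powr a" if "0 \<le> s" "s \<le> t" "t \<le> 1" for s t
  proof -
    have "g t * f s \<le> g s * f t" using fg that unfolding ratio_le_def by simp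
    then have "(g t * f s) powr a \<le> (g s * f t) powr a"
      using a that profileD(4)[OF f(1)] profileD(4)[OF g(1)] by (intro powr_mono2) auto
    then show ?thesis by (simp add: powr_mult)
  qed
  then have "ratio_le (\<lambda>s. g s powr a) (\<lambda>s. f s powr a)" unfolding ratio_le_def by simp
  from ratio_le_green[OF intf intg this] show ?thesis
    unfolding ratio_le_def profile_step_def using posf posg by (simp add: divide_right_mono)
qed

text \<open>The quotient is \<open>1\<close> at \<open>0\<close>, so a nonincreasing quotient stays
  below \<open>1\<close>. This turns the quotient order into pointwise monotonicity of the
  iterates.\<close>

lemma ratio_le_profile_imp_le:
  assumes "profile f" "profile g" "ratio_le g f" "t \<in> {0..1}"
  shows "g t \<le> f t"
proof -
  have "g t * f 0 \<le> g 0 * f t" using assms unfolding ratio_le_def by simp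
  then show ?thesis using assms by (simp add: profileD(1))
qed

text \<open>Convergence is pointwise; continuity of the limit is recovered later from the fixed
  point equations.\<close>

lemma profile_limit:
  assumes f: "\<And>n. profile (f n)" and anti: "\<And>n t. t \<in> {0..1} \<Longrightarrow> f (Suc n) t \<le> f n t"
  obtains g where "profile g" "\<And>t. t \<in> {0..1} \<Longrightarrow> (\<lambda>n. f n t) \<longlonglongrightarrow> g t"
proof -
  have lim: "(\<lambda>n. f n t) \<longlonglongrightarrow> lim (\<lambda>n. f n t)" if t: "t \<in> {0..1}" for t
  proof -
    have "decseq (\<lambda>n. f n t)" using anti[OF t] by (simp add: decseq_Suc_iff)
    then obtain L where "(\<lambda>n. f n t) \<longlonglongrightarrow> L"
      using decseq_convergent[of "\<lambda>n. f n t" 0] profileD(4)[OF f t] by blast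
    then show ?thesis by (simp add: limI)
  qed
  show ?thesis
  proof (rule that[of "\<lambda>t. lim (\<lambda>n. f n t)"])
    have "1 - t \<le> lim (\<lambda>n. f n t) \<and> lim (\<lambda>n. f n t) \<le> 1" if t: "t \<in> {0..1}" for t
      using LIMSEQ_le_const[OF lim[OF t], of "1 - t"] LIMSEQ_le_const2[OF lim[OF t], of 1]
        profileD(2,3)[OF f t] by auto
    moreover have "lim (\<lambda>n. f n 0) = 1" by (simp add: profileD(1)[OF f])
    ultimately show "profile (\<lambda>t. lim (\<lambda>n. f n t))" unfolding profile_def by simp
  qed (rule lim)
qed

lemma profile_step_tendsto:
  assumes f: "\<And>n. profile (f n)" "\<And>n. continuous_on {0..1} (f n)" and g: "profile g"
    and lim: "\<And>t. t \<in> {0..1} \<Longrightarrow> (\<lambda>n. f n t) \<longlonglongrightarrow> g t" and a: "0 < a"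
  shows "(\<lambda>s. g s powr a) integrable_on {0..1}"
    and "t \<in> {0..1} \<Longrightarrow> (\<lambda>n. profile_step a (f n) t) \<longlonglongrightarrow> profile_step a g t"
proof -
  note int = profile_powr_integrable[OF f a]
  have le: "\<bar>f n x powr a\<bar> \<le> 1" if "x \<in> {0..1}" for n x
    using powr_mono2[of a "f n x" 1] a profileD(3,4)[OF f(1) that] by simp
  have lima: "(\<lambda>n. f n x powr a) \<longlonglongrightarrow> g x powr a" if "x \<in> {0..1}" for x
    using a profileD(4)[OF f(1) that] by (intro tendsto_powr' lim that tendsto_const) auto
  note G = green_tendsto[of "\<lambda>n s. f n s powr a" "\<lambda>s. g s powr a", OF int le lima]
  show gi: "(\<lambda>s. g s powr a) integrable_on {0..1}" by (rule G(1))
  show "(\<lambda>n. profile_step a (f n) t) \<longlonglongrightarrow> profile_step a g t" if "t \<in> {0..1}"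
    unfolding profile_step_def
    using profile_green_pos[OF g a gi] by (intro tendsto_divide G(2)) (use that in auto)
qed

text \<open>The constant \<open>1\<close> is the top element of the quotient order among nonincreasing profiles, so the
  iteration started there decreases.\<close>

lemma profile_pair_exists:
  assumes ab: "0 < a" "0 < b"
  obtains u w where "profile u" "profile w"
    "(\<lambda>s. u s powr b) integrable_on {0..1}" "(\<lambda>s. w s powr a) integrable_on {0..1}"
    "\<And>t. t \<in> {0..1} \<Longrightarrow> u t = profile_step a w t" "\<And>t. t \<in> {0..1} \<Longrightarrow> w t = profile_step b u t"
proof -
  define U where "U = (\<lambda>n. ((\<lambda>f. profile_step a (profile_step b f)) ^^ n) (\<lambda>_. 1))"
  define W where "W = (\<lambda>n. profile_step b (U n))"
  have U0: "U 0 = (\<lambda>_. 1)" and US: "U (Suc n) = profile_step a (W n)" for n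
    by (simp_all add: U_def W_def)
  have step: "profile (profile_step r f) \<and> continuous_on {0..1} (profile_step r f)"
    if "profile f \<and> continuous_on {0..1} f" "0 < r" for f r
    using profile_step_profile(1,2)[of f r] that by simp
  have pU: "profile (U n) \<and> continuous_on {0..1} (U n)" for n
  proof (induction n)
    case 0
    then show ?case by (auto simp: U0 profile_def)
  next
    case (Suc n)
    then show ?case unfolding US W_def by (intro step ab)
  qed
  then have pW: "profile (W n) \<and> continuous_on {0..1} (W n)" for n
    unfolding W_def by (intro step ab)
  have rW: "ratio_le (W (Suc n)) (W n)" if "ratio_le (U (Suc n)) (U n)" for n
    unfolding W_def by (rule profile_step_mono[OF _ _ _ _ ab(2) that]) (use pU in auto)
  have rU: "ratio_le (U (Suc n)) (U n)" for n
  proof (induction n)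
    case 0
    have "U (Suc 0) t \<le> U (Suc 0) s" if "0 \<le> s" "s \<le> t" "t \<le> 1" for s t
      unfolding US by (rule profile_step_profile(3)[OF _ _ ab(1) that]) (use pW in auto)
    then show ?case by (simp add: ratio_le_def U0)
  next
    case (Suc n)
    show ?case unfolding US[of n] US[of "Suc n"]
      by (rule profile_step_mono[OF _ _ _ _ ab(1) rW[OF Suc]]) (use pW in auto)
  qed
  have aU: "U (Suc n) t \<le> U n t" and aW: "W (Suc n) t \<le> W n t" if "t \<in> {0..1}" for n t
    using ratio_le_profile_imp_le[OF _ _ _ that] pU pW rU rW[OF rU] by auto
  obtain u where u: "profile u" "\<And>t. t \<in> {0..1} \<Longrightarrow> (\<lambda>n. U n t) \<longlonglongrightarrow> u t"
    by (rule profile_limit[of U]) (use pU aU in auto)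
  obtain w where w: "profile w" "\<And>t. t \<in> {0..1} \<Longrightarrow> (\<lambda>n. W n t) \<longlonglongrightarrow> w t"
    by (rule profile_limit[of W]) (use pW aW in auto)
  note TU = profile_step_tendsto[of U u b, OF _ _ u ab(2)]
  note TW = profile_step_tendsto[of W w a, OF _ _ w ab(1)]
  show ?thesis
  proof (rule that[OF u(1) w(1)])
    show "(\<lambda>s. u s powr b) integrable_on {0..1}" by (rule TU(1)) (use pU in auto)
    show "(\<lambda>s. w s powr a) integrable_on {0..1}" by (rule TW(1)) (use pW in auto)
    fix t :: real assume t: "t \<in> {0..1}"
    \<comment> \<open>The limit is taken in the recursion. The one for \<open>U\<close> shifts the
      index by one, the one for \<open>W\<close> does not.\<close>
    have "(\<lambda>n. U (Suc n) t) \<longlonglongrightarrow> profile_step a w t" unfolding US by (rule TW(2)) (use pW t in auto)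
    then show "u t = profile_step a w t" using LIMSEQ_unique LIMSEQ_Suc[OF u(2)[OF t]] by blast
    have "(\<lambda>n. W n t) \<longlonglongrightarrow> profile_step b u t" unfolding W_def by (rule TU(2)) (use pU t in auto)
    then show "w t = profile_step b u t" using LIMSEQ_unique w(2)[OF t] by blast
  qed
qed

section \<open>Even reflection and existence\<close>

text \<open>The half interval is rescaled to length \<open>L\<close>, with its centre at \<open>L\<close>; \<open>k = 1\<close> gives the even and
  \<open>k = - 1\<close> the odd extension.\<close>

definition reflect :: "real \<Rightarrow> real \<Rightarrow> (real \<Rightarrow> real) \<Rightarrow> real \<Rightarrow> real" where
  "reflect L k g t = (if t \<le> L then k * g ((L - t) / L) else g ((t - L) / L))"

text \<open>The conditions on \<open>k\<close> make values and slopes of both branches agree at the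
  centre: \<open>g' 0 = 0\<close> for the even extension, \<open>g 0 = 0\<close> for the odd one.
  Differentiation changes parity.\<close>

lemma reflect_deriv:
  assumes L: "0 < L" and t: "t \<in> {0..2 * L}"
    and g: "\<And>x. x \<in> {0..1} \<Longrightarrow> (g has_real_derivative g' x) (at x within {0..1})"
    and k: "k * g 0 = g 0" "- k * g' 0 = g' 0"
  shows "(reflect L k g has_real_derivative reflect L (- k) g' t / L) (at t within {0..2 * L})"
proof -
  have left: "((\<lambda>t. k * g ((L - t) / L)) has_real_derivative - k * g' ((L - x) / L) / L) (at x within {0..L})"
    if x: "x \<in> {0..L}" for x
  proof -
    have "(\<lambda>t. (L - t) / L) ` {0..L} \<subseteq> {0..1}" using L by auto
    then have "(g has_real_derivative g' ((L - x) / L)) (at ((L - x) / L) within (\<lambda>t. (L - t) / L) ` {0..L})"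
      by (rule has_field_derivative_subset[OF g, rotated]) (use L x in auto)
    moreover have "((\<lambda>t. (L - t) / L) has_real_derivative - 1 / L) (at x within {0..L})"
      using L by (auto intro!: derivative_eq_intros)
    ultimately have "(g \<circ> (\<lambda>t. (L - t) / L) has_real_derivative g' ((L - x) / L) * (- 1 / L)) (at x within {0..L})"
      by (rule DERIV_image_chain)
    from DERIV_cmult[OF this, of k] show ?thesis by (simp add: o_def)
  qed
  have right: "((\<lambda>t. g ((t - L) / L)) has_real_derivative g' ((x - L) / L) / L) (at x within {L..2 * L})"
    if x: "x \<in> {L..2 * L}" for x
  proof -
    have "(\<lambda>t. (t - L) / L) ` {L..2 * L} \<subseteq> {0..1}" using L by (auto simp: field_simps)
    then have "(g has_real_derivative g' ((x - L) / L)) (at ((x - L) / L) within (\<lambda>t. (t - L) / L) ` {L..2 * L})"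
      by (rule has_field_derivative_subset[OF g, rotated]) (use L x in \<open>auto simp: field_simps\<close>)
    moreover have "((\<lambda>t. (t - L) / L) has_real_derivative 1 / L) (at x within {L..2 * L})"
      using L by (auto intro!: derivative_eq_intros)
    ultimately have "(g \<circ> (\<lambda>t. (t - L) / L) has_real_derivative g' ((x - L) / L) * (1 / L)) (at x within {L..2 * L})"
      by (rule DERIV_image_chain)
    then show ?thesis by (simp add: o_def)
  qed
  \<comment> \<open>The gluing rule enlarges each piece by the overlap of the closures. Here that is
    the point \<open>L\<close>, which both pieces already contain.\<close>
  have sets: "{0..2 * L} = {0..L} \<union> {L..2 * L}" "{0..L} \<union> (closure {0..L} \<inter> closure {L..2 * L}) = {0..L}"
    "{L..2 * L} \<union> (closure {0..L} \<inter> closure {L..2 * L}) = {L..2 * L}"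
    using L by auto
  have glue: "((\<lambda>t. if t \<in> {0..L} then k * g ((L - t) / L) else g ((t - L) / L)) has_vector_derivative
      (if t \<in> {0..L} then - k * g' ((L - t) / L) / L else g' ((t - L) / L) / L)) (at t within {0..2 * L})"
  proof (rule has_vector_derivative_If_within_closures[OF _ sets(1)], unfold sets(2,3))
    show "t \<in> {0..L} \<union> {L..2 * L}" using t unfolding sets(1) .
    show "((\<lambda>t. k * g ((L - t) / L)) has_vector_derivative - k * g' ((L - t) / L) / L) (at t within {0..L})"
      if "t \<in> {0..L}"
      using left[OF that] by (simp add: has_real_derivative_iff_has_vector_derivative)
    show "((\<lambda>t. g ((t - L) / L)) has_vector_derivative g' ((t - L) / L) / L) (at t within {L..2 * L})"
      if "t \<in> {L..2 * L}"
      using right[OF that] by (simp add: has_real_derivative_iff_has_vector_derivative)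
    assume "t \<in> closure {0..L}" "t \<in> closure {L..2 * L}"
    then have "t = L" by auto
    with k show "k * g ((L - t) / L) = g ((t - L) / L)" "- k * g' ((L - t) / L) / L = g' ((t - L) / L) / L"
      by simp_all
  qed
  have "(reflect L k g has_vector_derivative
      (if t \<in> {0..L} then - k * g' ((L - t) / L) / L else g' ((t - L) / L) / L)) (at t within {0..2 * L})"
    by (rule has_vector_derivative_transform[OF t _ glue]) (auto simp: reflect_def)
  moreover have "(if t \<in> {0..L} then - k * g' ((L - t) / L) / L else g' ((t - L) / L) / L)
      = reflect L (- k) g' t / L"
    using t by (auto simp: reflect_def)
  ultimately show ?thesis by (simp add: has_real_derivative_iff_has_vector_derivative)
qed

lemma reflect_even: "0 < L \<Longrightarrow> reflect L 1 g t = g (\<bar>t - L\<bar> / L)"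
  by (auto simp: reflect_def abs_minus_commute)

text \<open>Rescaling to half length \<open>L\<close> turns \<mu> and \<nu> into
  \<open>\<mu> / L\<^sup>2\<close> and \<open>\<nu> / L\<^sup>2\<close>. The equations for
  \<open>c\<close> and \<open>d\<close> absorb these factors into the amplitudes and
  \<open>lam\<close>.\<close>

lemma emden_bvp_from_profiles:
  assumes ab: "0 < a" "0 < b" and pu: "profile u" and pw: "profile w"
    and ui: "(\<lambda>s. u s powr b) integrable_on {0..1}" and wi: "(\<lambda>s. w s powr a) integrable_on {0..1}"
    and u: "\<And>t. t \<in> {0..1} \<Longrightarrow> u t = \<mu> * green (\<lambda>s. w s powr a) t"
    and w: "\<And>t. t \<in> {0..1} \<Longrightarrow> w t = \<nu> * green (\<lambda>s. u s powr b) t"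
    and L: "0 < L" and cd: "0 < c" "0 < d" and c: "c * (\<mu> / L\<^sup>2) = d powr a" and d: "d * (\<nu> / L\<^sup>2) = lam * c powr b"
  shows "\<exists>u du w dw. emden_bvp a b lam (2 * L) u du w dw"
proof -
  define F where "F = (\<lambda>t. - (\<mu> * integral {0..t} (\<lambda>s. w s powr a)))"
  define G where "G = (\<lambda>t. - (\<nu> * integral {0..t} (\<lambda>s. u s powr b)))"
  have u': "(u has_real_derivative F t) (at t within {0..1})" if t: "t \<in> {0..1}" for t
    by (rule has_field_derivative_transform_within[OF _ zero_less_one t, of "\<lambda>t. \<mu> * green (\<lambda>s. w s powr a) t"])
       (use DERIV_cmult[OF green_deriv[OF wi t], of \<mu>] u in \<open>auto simp: F_def\<close>)
  have w': "(w has_real_derivative G t) (at t within {0..1})" if t: "t \<in> {0..1}" for t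
    by (rule has_field_derivative_transform_within[OF _ zero_less_one t, of "\<lambda>t. \<nu> * green (\<lambda>s. u s powr b) t"])
       (use DERIV_cmult[OF green_deriv[OF ui t], of \<nu>] w in \<open>auto simp: G_def\<close>)
  \<comment> \<open>Regularity is bootstrapped: the fixed point equations make the profiles
    differentiable, hence their powers continuous, so \<open>F\<close> and \<open>G\<close> are
    differentiable too.\<close>
  have cont: "continuous_on {0..1} (\<lambda>s. w s powr a)" "continuous_on {0..1} (\<lambda>s. u s powr b)"
    using DERIV_continuous_on[OF u'] DERIV_continuous_on[OF w'] profileD(4)[OF pu] profileD(4)[OF pw] ab
    by (auto intro!: continuous_on_powr')
  have F': "(F has_real_derivative - (\<mu> * w t powr a)) (at t within {0..1})" if t: "t \<in> {0..1}" for t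
    unfolding F_def by (intro DERIV_minus DERIV_cmult integral_has_real_derivative cont t)
  have G': "(G has_real_derivative - (\<nu> * u t powr b)) (at t within {0..1})" if t: "t \<in> {0..1}" for t
    unfolding G_def by (intro DERIV_minus DERIV_cmult integral_has_real_derivative cont t)
  have FG0: "F 0 = 0" "G 0 = 0" by (simp_all add: F_def G_def)
  have dom: "\<bar>t - L\<bar> / L \<in> {0..1}" if "t \<in> {0..2 * L}" for t
    using that L by (auto simp: field_simps abs_le_iff)
  define U where "U = (\<lambda>t. c * reflect L 1 u t)"
  define DU where "DU = (\<lambda>t. c / L * reflect L (- 1) F t)"
  define W where "W = (\<lambda>t. d * reflect L 1 w t)"
  define DW where "DW = (\<lambda>t. d / L * reflect L (- 1) G t)"
  have U': "(U has_real_derivative DU t) (at t within {0..2 * L})" if "t \<in> {0..2 * L}" for t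
    using DERIV_cmult[OF reflect_deriv[OF L that u', of 1], of c] FG0 by (simp add: U_def DU_def)
  have W': "(W has_real_derivative DW t) (at t within {0..2 * L})" if "t \<in> {0..2 * L}" for t
    using DERIV_cmult[OF reflect_deriv[OF L that w', of 1], of d] FG0 by (simp add: W_def DW_def)
  have DU': "(DU has_real_derivative - (W t powr a)) (at t within {0..2 * L})" if t: "t \<in> {0..2 * L}" for t
  proof -
    have "W t powr a = c * (\<mu> / L\<^sup>2) * w (\<bar>t - L\<bar> / L) powr a"
      unfolding W_def c reflect_even[OF L] by (rule powr_mult)
    then have "- (W t powr a) = c / L * (reflect L 1 (\<lambda>t. - (\<mu> * w t powr a)) t / L)"
      unfolding reflect_even[OF L] by (simp add: power2_eq_square)
    then show ?thesis
      using DERIV_cmult[OF reflect_deriv[OF L t F', of "- 1"], of "c / L"] FG0 by (simp add: DU_def)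
  qed
  have DW': "(DW has_real_derivative - lam * U t powr b) (at t within {0..2 * L})" if t: "t \<in> {0..2 * L}" for t
  proof -
    have "lam * U t powr b = (lam * c powr b) * u (\<bar>t - L\<bar> / L) powr b"
      unfolding U_def reflect_even[OF L] by (simp add: powr_mult)
    also have "\<dots> = d * (\<nu> / L\<^sup>2) * u (\<bar>t - L\<bar> / L) powr b" by (simp only: d)
    finally have "- lam * U t powr b = d / L * (reflect L 1 (\<lambda>t. - (\<nu> * u t powr b)) t / L)"
      unfolding reflect_even[OF L] by (simp add: power2_eq_square)
    then show ?thesis
      using DERIV_cmult[OF reflect_deriv[OF L t G', of "- 1"], of "d / L"] FG0 by (simp add: DW_def)
  qed
  have "emden_ivp a b lam (2 * L) U DU W DW"
    unfolding emden_ivp_def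
  proof (intro conjI ballI)
    fix t assume t: "t \<in> {0..2 * L}"
    show "0 \<le> U t" "0 \<le> W t"
      using profileD(4)[OF pu dom[OF t]] profileD(4)[OF pw dom[OF t]] cd
      by (auto simp: U_def W_def reflect_even[OF L])
  next
    show "U 0 = 0" "W 0 = 0" using u[of 1] w[of 1] L by (auto simp: U_def W_def reflect_even[OF L])
  qed (fact U' DU' W' DW')+
  moreover have "U (2 * L) = 0" "W (2 * L) = 0"
    using u[of 1] w[of 1] L by (auto simp: U_def W_def reflect_even[OF L])
  moreover have "0 < U t \<and> 0 < W t" if t: "t \<in> {0<..<2 * L}" for t
  proof -
    have "t \<in> {0..2 * L}" "\<bar>t - L\<bar> / L < 1" using t L by (auto simp: field_simps abs_less_iff)
    then have "0 < u (\<bar>t - L\<bar> / L)" "0 < w (\<bar>t - L\<bar> / L)"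
      using profileD(2)[OF pu dom[of t]] profileD(2)[OF pw dom[of t]] by auto
    then show ?thesis using cd by (simp add: U_def W_def reflect_even[OF L])
  qed
  ultimately show ?thesis unfolding emden_bvp_def by blast
qed

section \<open>Choice of amplitudes and eigenvalue\<close>

text \<open>In logarithms the system for \<open>c\<close> and \<open>d\<close> is linear, and
  eliminating \<open>ln d\<close> leaves the coefficient \<open>1 / a - b\<close> of
  \<open>ln c\<close>, nonzero exactly when \<open>a * b \<noteq> 1\<close>. With \<open>lam\<close>
  free, one may take \<open>c = 1\<close> and \<open>d = m powr (1 / a)\<close> and read off
  \<open>lam\<close>.\<close>

lemma amplitudes_exist:
  fixes a b m n :: real
  assumes pos: "0 < a" "0 < b" "0 < m" "0 < n"
  shows "a * b \<noteq> 1 \<Longrightarrow> 0 < lam \<Longrightarrow> \<exists>c>0. \<exists>d>0. c * m = d powr a \<and> d * n = lam * c powr b"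
    and "\<exists>lam>0. \<exists>c>0. \<exists>d>0. c * m = d powr a \<and> d * n = lam * c powr b"
proof -
  have "0 < m powr (1 / a) * n" "1 * m = (m powr (1 / a)) powr a"
    "m powr (1 / a) * n = m powr (1 / a) * n * 1 powr b" "0 < m powr (1 / a)"
    using pos by (simp_all add: powr_powr)
  then show "\<exists>lam>0. \<exists>c>0. \<exists>d>0. c * m = d powr a \<and> d * n = lam * c powr b"
    using zero_less_one by blast
  assume ab: "a * b \<noteq> 1" and lam: "0 < lam"
  define \<gamma> where "\<gamma> = (ln lam - ln n - ln m / a) / (1 / a - b)"
  define \<delta> where "\<delta> = (\<gamma> + ln m) / a"
  have "1 / a - b \<noteq> 0" using ab pos by (simp add: field_simps)
  then have "\<gamma> * (1 / a - b) = ln lam - ln n - ln m / a" unfolding \<gamma>_def by simp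
  then have 1: "\<delta> + ln n = ln lam + b * \<gamma>"
    unfolding \<delta>_def by (simp add: algebra_simps add_divide_distrib)
  have 2: "\<gamma> + ln m = a * \<delta>" unfolding \<delta>_def using pos by simp
  have "exp \<gamma> * m = exp \<delta> powr a"
    using arg_cong[OF 2, of exp] pos by (simp add: powr_def exp_add)
  moreover have "exp \<delta> * n = lam * exp \<gamma> powr b"
    using arg_cong[OF 1, of exp] pos lam by (simp add: powr_def exp_add)
  ultimately show "\<exists>c>0. \<exists>d>0. c * m = d powr a \<and> d * n = lam * c powr b"
    by (intro exI[of _ "exp \<gamma>"] exI[of _ "exp \<delta>"] conjI) auto
qed

lemma emden_bvp_exists:
  assumes ab: "0 < a" "0 < b" and T: "0 < T"
  shows "a * b \<noteq> 1 \<Longrightarrow> 0 < lam \<Longrightarrow> \<exists>u du w dw. emden_bvp a b lam T u du w dw"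
    and "\<exists>lam>0. \<exists>u du w dw. emden_bvp a b lam T u du w dw"
proof -
  obtain u w where p: "profile u" "profile w"
    and int: "(\<lambda>s. u s powr b) integrable_on {0..1}" "(\<lambda>s. w s powr a) integrable_on {0..1}"
    and eq: "\<And>t. t \<in> {0..1} \<Longrightarrow> u t = profile_step a w t" "\<And>t. t \<in> {0..1} \<Longrightarrow> w t = profile_step b u t"
    using profile_pair_exists[OF ab] by blast
  \<comment> \<open>\<mu> and \<nu> are the normalising factors hidden in
    \<open>profile_step\<close>.\<close>
  define \<mu> where "\<mu> = 1 / green (\<lambda>s. w s powr a) 0"
  define \<nu> where "\<nu> = 1 / green (\<lambda>s. u s powr b) 0"
  have pos: "0 < \<mu> / (T / 2)\<^sup>2" "0 < \<nu> / (T / 2)\<^sup>2"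
    using profile_green_pos[OF p(2) ab(1) int(2)] profile_green_pos[OF p(1) ab(2) int(1)] T
    by (simp_all add: \<mu>_def \<nu>_def)
  have sol: "\<exists>u du w dw. emden_bvp a b lam T u du w dw"
    if cd: "0 < c" "0 < d" "c * (\<mu> / (T / 2)\<^sup>2) = d powr a" "d * (\<nu> / (T / 2)\<^sup>2) = lam * c powr b" for c d lam
  proof -
    have "0 < T / 2" using T by simp
    have "\<exists>u du w dw. emden_bvp a b lam (2 * (T / 2)) u du w dw"
      by (rule emden_bvp_from_profiles[OF ab p int _ _ \<open>0 < T / 2\<close> cd])
         (simp_all add: eq profile_step_def \<mu>_def \<nu>_def)
    then show ?thesis by simp
  qed
  show "\<exists>u du w dw. emden_bvp a b lam T u du w dw" if P: "a * b \<noteq> 1" "0 < lam"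
  proof -
    obtain c d where "0 < c" "0 < d" "c * (\<mu> / (T / 2)\<^sup>2) = d powr a" "d * (\<nu> / (T / 2)\<^sup>2) = lam * c powr b"
      using amplitudes_exist(1)[OF ab pos P] by blast
    then show ?thesis by (rule sol)
  qed
  show "\<exists>lam>0. \<exists>u du w dw. emden_bvp a b lam T u du w dw"
  proof -
    obtain lam c d where "0 < lam" and cd: "0 < c" "0 < d" "c * (\<mu> / (T / 2)\<^sup>2) = d powr a"
      "d * (\<nu> / (T / 2)\<^sup>2) = lam * c powr b"
      using amplitudes_exist(2)[OF ab pos] by blast
    with sol[OF cd] show ?thesis by blast
  qed
qed

theorem theorem2p1:
  fixes p q t0 :: real
  assumes "1 < p" and "1 < q" and "0 < t0"
  shows "(p \<noteq> q \<longrightarrow>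
            (\<forall>lam>0. \<exists>u. positive_eigenpair p q t0 u lam \<and>
               (\<forall>v. positive_eigenpair p q t0 v lam \<longrightarrow> (\<forall>t\<in>{0..t0}. v t = u t)))) \<and>
         (p = q \<longrightarrow>
            (\<exists>!lam. lam > 0 \<and> (\<exists>u. positive_eigenpair p q t0 u lam)) \<and>
            (\<forall>lam u v. positive_eigenpair p q t0 u lam \<and> positive_eigenpair p q t0 v lam \<longrightarrow>
               (\<exists>c. \<forall>t\<in>{0..t0}. v t = c * u t)))"
proof -
  define a where "a = 1 / (p - 1)"
  define b where "b = q - 1"
  have ab: "0 < a" "0 < b" and prod: "a * b = 1 \<longleftrightarrow> p = q"
    using assms by (auto simp: a_def b_def field_simps)
  have to_bvp: "0 < lam \<and> (\<exists>du w dw. emden_bvp a b lam t0 u du w dw)" if "positive_eigenpair p q t0 u lam" for u lam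
    using positive_eigenpair_imp_emden_bvp[OF assms(1,3) that] unfolding a_def b_def by blast
  have of_bvp: "positive_eigenpair p q t0 u lam" if "0 < lam" "emden_bvp a b lam t0 u du w dw" for u du w dw lam
    using emden_bvp_imp_positive_eigenpair[OF assms that(1)] that(2) unfolding a_def b_def by blast
  have unique: "\<exists>c>0. \<exists>d>0. c = d powr a \<and> d * l1 = l2 * c powr b \<and> (\<forall>t\<in>{0..t0}. v t = c * u t)"
    if "positive_eigenpair p q t0 u l1" "positive_eigenpair p q t0 v l2" for u v l1 l2
    using to_bvp[OF that(1)] to_bvp[OF that(2)] emden_bvp_unique[OF _ _ ab _ _ assms(3)] by metis
  show ?thesis
  proof (intro conjI impI allI)
    fix lam :: real assume "p \<noteq> q" and lam: "0 < lam"
    then have "a * b \<noteq> 1" using prod by simp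
    from emden_bvp_exists(1)[OF ab assms(3) this lam] obtain u where u: "positive_eigenpair p q t0 u lam"
      using of_bvp[OF lam] by blast
    have "v t = u t" if v: "positive_eigenpair p q t0 v lam" and t: "t \<in> {0..t0}" for v t
    proof -
      obtain c d where c: "0 < c" "0 < d" "c = d powr a" "d * lam = lam * c powr b" "v t = c * u t"
        using unique[OF u v] t by blast
      \<comment> \<open>Eliminating \<open>d\<close> leaves \<open>c = c powr (a * b)\<close>, which
        forces \<open>ln c = 0\<close> when \<open>a * b \<noteq> 1\<close>.\<close>
      then have "c = (c powr b) powr a" using lam by simp
      then have "ln c = a * b * ln c" using c(1) by (metis ln_powr mult.commute mult.left_commute powr_powr)
      then have "c = 1" using \<open>a * b \<noteq> 1\<close> c(1) by simp
      then show ?thesis using c by simp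
    qed
    with u show "\<exists>u. positive_eigenpair p q t0 u lam \<and>
        (\<forall>v. positive_eigenpair p q t0 v lam \<longrightarrow> (\<forall>t\<in>{0..t0}. v t = u t))" by blast
  next
    assume "p = q"
    then have ba: "a * b = 1" using prod by simp
    obtain lam where lam: "0 < lam" "\<exists>u. positive_eigenpair p q t0 u lam"
      using emden_bvp_exists(2)[OF ab assms(3)] of_bvp by blast
    have "l1 = l2" if P: "positive_eigenpair p q t0 u l1" "positive_eigenpair p q t0 v l2" for u v l1 l2
    proof -
      obtain c d where "0 < d" "c = d powr a" "d * l1 = l2 * c powr b"
        using unique[OF P] by blast
      \<comment> \<open>Here \<open>c powr b = d powr (a * b) = d\<close>, so \<open>d\<close>
        cancels and the eigenvalues agree.\<close>
      then show ?thesis using ba by (simp add: powr_powr)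
    qed
    with lam show "\<exists>!lam. lam > 0 \<and> (\<exists>u. positive_eigenpair p q t0 u lam)" by blast
  next
    fix lam u v assume "positive_eigenpair p q t0 u lam \<and> positive_eigenpair p q t0 v lam"
    then show "\<exists>c. \<forall>t\<in>{0..t0}. v t = c * u t" using unique by blast
  qed
qed

end
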